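(* Let $\mu$ be a radial Carleson--Bergman measure on $\mathbb{D}$ of the form $\mu=\nu_\eta$, where $\eta$ is a finite Borel measure on $[0,1)$. Then $$R\,T_\mu R^\ast = M_{\gamma_\eta},$$ where $\gamma_\eta(k)=2(k+1)\int_{[0,1)} r^{2k}\,\mathrm{d}\eta(r)$ for $k\in\mathbb{N}_0$.
   Context: $\mathbb{D}$ is the open unit disk, $\mathbb{T}$ the unit circle, $\mathbb{N}_0=\{0,1,2,\ldots\}$, $\lambda_{\mathbb{C}}$ the Lebesgue plane measure. $A^2(\mathbb{D})$ is the Bergman space of analytic functions in $L_2(\mathbb{D},\lambda_{\mathbb{C}})$, with the inner product of $L_2(\mathbb{D},\lambda_{\mathbb{C}})$. A finite Borel measure $\mu$ on $\mathbb{D}$ is a Carleson--Bergman measure if there is $C\ge0$ with $\int_{\mathbb{D}}|f|^2\,\mathrm{d}\mu\le C\int_{\mathbb{D}}|f|^2\,\mathrm{d}\lambda_{\mathbb{C}}$ for every $f\in A^2(\mathbb{D})$. It is radial if $\mu(\tau Z)=\mu(Z)$ for all $\tau\in\mathbb{T}$ and all Borel $Z\subseteq\mathbb{D}$. For a finite Borel measure $\eta$ on $[0,1)$, $\nu_\eta$ is the pushforward of $\eta\times\lambda_{\mathbb{T}}$ under $[0,1)\times\mathbb{T}\to\mathbb{D}$, $(r,\tau)\mapsto r\tau$, where $\lambda_{\mathbb{T}}$ is the Haar measure on $\mathbb{T}$ with $\lambda_{\mathbb{T}}(\mathbb{T})=2\pi$. The Toeplitz operator is $(T_\mu f)(z)=\frac1\pi\int_{\mathbb{D}}\frac{f(w)}{(1-z\overline{w})^2}\,\mathrm{d}\mu(w)$;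 for a Carleson--Bergman measure $\mu$ it is a bounded operator on $A^2(\mathbb{D})$ and $\langle T_\mu f,g\rangle=\int_{\mathbb{D}}f\overline{g}\,\mathrm{d}\mu$ for $f,g\in A^2(\mathbb{D})$ (known facts). The canonical orthonormal basis of $A^2(\mathbb{D})$ is $b_k(z)=\sqrt{\frac{k+1}{\pi}}\,z^k$, $k\in\mathbb{N}_0$. The operator $R\colon A^2(\mathbb{D})\to\ell_2(\mathbb{N}_0)$ is the isometric isomorphism $(Rf)(k)=\sqrt{\frac{k+1}{\pi}}\int_{[0,1)}\int_{\mathbb{T}}f(r\tau)\tau^{-k}r^{k+1}\,\mathrm{d}\lambda_{\mathbb{T}}(\tau)\,\mathrm{d}r=\langle f,b_k\rangle$. For a sequence $\alpha\in\ell_\infty(\mathbb{N}_0)$, $M_\alpha$ is the multiplication operator $M_\alpha c=(\alpha_kc_k)_{k\in\mathbb{N}_0}$ on $\ell_2(\mathbb{N}_0)$. *)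

theory Defs
  imports "HOL-Analysis.Analysis"
begin

abbreviation unit_disk :: "complex set" where
  "unit_disk \<equiv> ball 0 1"

abbreviation unit_circle :: "complex set" where
  "unit_circle \<equiv> sphere 0 1"

definition disk_borel :: "complex measure" where
  "disk_borel = restrict_space borel unit_disk"

definition disk_lebesgue :: "complex measure" where
  "disk_lebesgue = restrict_space lborel unit_disk"

text \<open>The Haar measure of total mass \<open>2 * pi\<close> on the circle, realised as arc length; see
  \<open>emeasure_circle_haar_space\<close> and \<open>emeasure_circle_haar_rotate\<close> below.\<close>
definition circle_haar :: "complex measure" where
  "circle_haar = distr (restrict_space lborel {0..<2 * pi}) (restrict_space borel unit_circle) cis"

definition finite_borel_disk :: "complex measure \<Rightarrow> bool" where
  "finite_borel_disk \<mu> \<longleftrightarrow> finite_measure \<mu> \<and> sets \<mu> = sets disk_borel"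

definition finite_borel_unit_interval :: "real measure \<Rightarrow> bool" where
  "finite_borel_unit_interval \<eta> \<longleftrightarrow>
     finite_measure \<eta> \<and> sets \<eta> = sets (restrict_space borel {0..<1})"

definition radial :: "complex measure \<Rightarrow> bool" where
  "radial \<mu> \<longleftrightarrow>
     (\<forall>\<tau>\<in>unit_circle. \<forall>Z\<in>sets borel. Z \<subseteq> unit_disk \<longrightarrow>
        emeasure \<mu> ((\<lambda>z. \<tau> * z) ` Z) = emeasure \<mu> Z)"

definition nu :: "real measure \<Rightarrow> complex measure" where
  "nu \<eta> = distr (\<eta> \<Otimes>\<^sub>M circle_haar) disk_borel (\<lambda>(r, \<tau>). of_real r * \<tau>)"

text \<open>An element of the space is a function on the disk; it is encoded by its extension by zero,
  so that two elements coincide iff they are equal as functions on \<^typ>\<open>complex\<close>.\<close>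
definition bergman :: "(complex \<Rightarrow> complex) set" where
  "bergman = {f. f holomorphic_on unit_disk \<and>
                 integrable disk_lebesgue (\<lambda>z. (cmod (f z))\<^sup>2) \<and>
                 (\<forall>z. z \<notin> unit_disk \<longrightarrow> f z = 0)}"

definition bergman_inner :: "(complex \<Rightarrow> complex) \<Rightarrow> (complex \<Rightarrow> complex) \<Rightarrow> complex" where
  "bergman_inner f g = (LINT z|disk_lebesgue. f z * cnj (g z))"

definition l2 :: "(nat \<Rightarrow> complex) set" where
  "l2 = {c. summable (\<lambda>k. (cmod (c k))\<^sup>2)}"

definition l2_inner :: "(nat \<Rightarrow> complex) \<Rightarrow> (nat \<Rightarrow> complex) \<Rightarrow> complex" where
  "l2_inner c d = (\<Sum>k. c k * cnj (d k))"

definition linf :: "(nat \<Rightarrow> complex) set" where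
  "linf = {\<alpha>. bounded (range \<alpha>)}"

text \<open>The integrals are taken in \<^typ>\<open>ennreal\<close>, so the left one is not assumed finite.\<close>
definition carleson_bergman :: "complex measure \<Rightarrow> bool" where
  "carleson_bergman \<mu> \<longleftrightarrow> finite_borel_disk \<mu> \<and>
     (\<exists>C\<ge>0. \<forall>f\<in>bergman.
        (\<integral>\<^sup>+z. ennreal ((cmod (f z))\<^sup>2) \<partial>\<mu>)
          \<le> ennreal C * (\<integral>\<^sup>+z. ennreal ((cmod (f z))\<^sup>2) \<partial>disk_lebesgue))"

definition toeplitz :: "complex measure \<Rightarrow> (complex \<Rightarrow> complex) \<Rightarrow> complex \<Rightarrow> complex" where
  "toeplitz \<mu> f = (\<lambda>z. if z \<in> unit_disk
      then 1 / of_real pi * (LINT w|\<mu>. f w / (1 - z * cnj w)\<^sup>2) else 0)"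

definition bergman_R :: "(complex \<Rightarrow> complex) \<Rightarrow> nat \<Rightarrow> complex" where
  "bergman_R f = (\<lambda>k. of_real (sqrt ((real k + 1) / pi)) *
      (LINT r:{0..<1}|lborel. LINT \<tau>|circle_haar.
         f (of_real r * \<tau>) * \<tau> powi (- int k) * of_real (r ^ (k + 1))))"

text \<open>The Hilbert space adjoint of \<open>A\<close>, an operator from the space \<open>H\<close> with inner product \<open>ipH\<close>
  into a space with inner product \<open>ipK\<close>; both products are linear in the first argument.\<close>
definition hilbert_adjoint ::
  "'h set \<Rightarrow> ('h \<Rightarrow> 'h \<Rightarrow> complex) \<Rightarrow> ('k \<Rightarrow> 'k \<Rightarrow> complex) \<Rightarrow> ('h \<Rightarrow> 'k) \<Rightarrow> 'k \<Rightarrow> 'h" where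
  "hilbert_adjoint H ipH ipK A = (\<lambda>y. THE x. x \<in> H \<and> (\<forall>f\<in>H. ipK (A f) y = ipH f x))"

definition bergman_R_adj :: "(nat \<Rightarrow> complex) \<Rightarrow> complex \<Rightarrow> complex" where
  "bergman_R_adj = hilbert_adjoint bergman bergman_inner l2_inner bergman_R"

definition mult_op :: "(nat \<Rightarrow> complex) \<Rightarrow> (nat \<Rightarrow> complex) \<Rightarrow> nat \<Rightarrow> complex" where
  "mult_op \<alpha> c = (\<lambda>k. \<alpha> k * c k)"

definition gamma_seq :: "real measure \<Rightarrow> nat \<Rightarrow> real" where
  "gamma_seq \<eta> k = 2 * (real k + 1) * (LINT r|\<eta>. r ^ (2 * k))"

lemma measurable_cis_circle [measurable]:
  "cis \<in> measurable (restrict_space lborel {0..<2 * pi}) (restrict_space borel unit_circle)"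
proof (rule measurable_restrict_space2)
  show "cis \<in> borel_measurable (restrict_space lborel {0..<2 * pi})"
    by (intro measurable_restrict_space1) (simp add: borel_measurable_continuous_onI continuous_intros)
qed auto

lemma sets_circle_haar: "sets circle_haar = sets (restrict_space borel unit_circle)"
  by (simp add: circle_haar_def)

lemma space_circle_haar: "space circle_haar = unit_circle"
  by (simp add: circle_haar_def space_restrict_space)

lemma emeasure_circle_haar:
  assumes "Z \<in> sets borel" "Z \<subseteq> unit_circle"
  shows "emeasure circle_haar Z = emeasure lborel {t \<in> {0..<2 * pi}. cis t \<in> Z}"
proof -
  have "Z \<in> sets (restrict_space borel unit_circle)"
    using assms by (auto simp: sets_restrict_space_iff)
  then have "emeasure circle_haar Z =
      emeasure (restrict_space lborel {0..<2 * pi}) (cis -` Z \<inter> {0..<2 * pi})"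
    by (simp add: circle_haar_def emeasure_distr space_restrict_space)
  also have "\<dots> = emeasure lborel {t \<in> {0..<2 * pi}. cis t \<in> Z}"
    by (subst emeasure_restrict_space) (auto intro!: arg_cong[where f = "emeasure lborel"])
  finally show ?thesis .
qed

lemma emeasure_circle_haar_space: "emeasure circle_haar (space circle_haar) = ennreal (2 * pi)"
proof -
  have *: "{t \<in> {0..<2 * pi}. cis t \<in> unit_circle} = {0..<2 * pi}" by auto
  show ?thesis
    by (simp only: space_circle_haar emeasure_circle_haar[OF _ order.refl] borel_closed closed_sphere *)
       simp
qed

lemma emeasure_circle_haar_rotate:
  assumes "\<tau> \<in> unit_circle" "Z \<in> sets borel" "Z \<subseteq> unit_circle"
  shows "emeasure circle_haar ((\<lambda>z. \<tau> * z) ` Z) = emeasure circle_haar Z"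
proof -
  have nz: "\<tau> \<noteq> 0" and n1: "cmod \<tau> = 1" using assms(1) by auto
  obtain a where a: "0 \<le> a" "a < 2 * pi" "\<tau> = cis a"
  proof
    show "0 \<le> Arg2pi \<tau>" "Arg2pi \<tau> < 2 * pi" by (auto simp: Arg2pi)
    show "\<tau> = cis (Arg2pi \<tau>)" using Arg2pi_eq[of \<tau>] n1 by (simp add: cis_conv_exp)
  qed
  have img: "(\<lambda>z. \<tau> * z) ` Z = (\<lambda>z. z / \<tau>) -` Z"
  proof (intro equalityI subsetI)
    fix x assume "x \<in> (\<lambda>z. z / \<tau>) -` Z"
    then show "x \<in> (\<lambda>z. \<tau> * z) ` Z"
      using nz by (intro image_eqI[of _ _ "x / \<tau>"]) auto
  qed (use nz in auto)
  have meas: "(\<lambda>z. z / \<tau>) \<in> borel_measurable borel"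
    by measurable
  have rB: "(\<lambda>z. \<tau> * z) ` Z \<in> sets borel"
    using measurable_sets[OF meas assms(2)] img by simp
  have rC: "(\<lambda>z. \<tau> * z) ` Z \<subseteq> unit_circle"
    using assms(3) n1 by (auto simp: norm_mult)
  define P where "P = {t. cis t \<in> Z}"
  have "cis \<in> borel_measurable borel"
    by (simp add: borel_measurable_continuous_onI continuous_intros)
  then have P: "P \<in> sets borel"
    using measurable_sets[of cis borel borel Z] assms(2) by (simp add: P_def vimage_def)
  have per: "t + 2 * pi \<in> P \<longleftrightarrow> t \<in> P" for t by (simp add: P_def cis_mult[symmetric])
  have shift: "emeasure lborel ((\<lambda>t. t + d) ` X) = emeasure lborel X" if "X \<in> sets borel" for d X
  proof -
    have *: "(\<lambda>t. t + d) ` X = (\<lambda>t. - d + t) -` X"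
      by (force intro: image_eqI[of _ _ "_ - d"])
    have "emeasure lborel X = emeasure (distr lborel borel ((+) (- d))) X"
      by (simp add: lborel_distr_plus)
    also have "\<dots> = emeasure lborel ((\<lambda>t. - d + t) -` X)"
      using that by (subst emeasure_distr) auto
    finally show ?thesis by (simp add: *)
  qed
  have mem: "cis t \<in> (\<lambda>z. \<tau> * z) ` Z \<longleftrightarrow> t - a \<in> P" for t
    unfolding img by (simp add: P_def a(3) cis_divide)
  define A where "A = P \<inter> {0..<2 * pi - a}"
  define B where "B = P \<inter> {2 * pi - a..<2 * pi}"
  have AB: "A \<in> sets borel" "B \<in> sets borel" using P by (auto simp: A_def B_def)
  have eq1: "{t \<in> {0..<2 * pi}. t - a \<in> P} = (\<lambda>t. t + a) ` A \<union> (\<lambda>t. t + (a - 2 * pi)) ` B"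
  proof (intro equalityI subsetI)
    fix t assume t: "t \<in> {t \<in> {0..<2 * pi}. t - a \<in> P}"
    show "t \<in> (\<lambda>t. t + a) ` A \<union> (\<lambda>t. t + (a - 2 * pi)) ` B"
    proof (cases "a \<le> t")
      case True
      then have "t - a \<in> A" using t by (auto simp: A_def)
      then show ?thesis by (auto intro!: image_eqI[of _ _ "t - a"])
    next
      case False
      then have "t - a + 2 * pi \<in> B" using t a per[of "t - a"] by (auto simp: B_def)
      then show ?thesis by (auto intro!: image_eqI[of _ _ "t - a + 2 * pi"])
    qed
  next
    fix t assume "t \<in> (\<lambda>t. t + a) ` A \<union> (\<lambda>t. t + (a - 2 * pi)) ` B"
    then show "t \<in> {t \<in> {0..<2 * pi}. t - a \<in> P}"
      using a per[of "t - a"] by (auto simp: A_def B_def per[of "_ - 2 * pi", symmetric])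
  qed
  have im: "(\<lambda>t. t + d) ` X \<in> sets borel" if "X \<in> sets borel" for d :: real and X
  proof -
    have *: "(\<lambda>t. t + d) ` X = (\<lambda>t. t - d) -` X"
      by (force intro: image_eqI[of _ _ "_ - d"])
    have "(\<lambda>t. t - d) \<in> borel_measurable borel" by measurable
    from measurable_sets[OF this that] show ?thesis by (simp add: *)
  qed
  have "emeasure circle_haar ((\<lambda>z. \<tau> * z) ` Z) = emeasure lborel {t \<in> {0..<2 * pi}. t - a \<in> P}"
    by (simp add: emeasure_circle_haar[OF rB rC] mem)
  also have "\<dots> = emeasure lborel ((\<lambda>t. t + a) ` A) + emeasure lborel ((\<lambda>t. t + (a - 2 * pi)) ` B)"
    unfolding eq1 using AB
    by (intro plus_emeasure[symmetric]) (auto simp: A_def B_def intro!: im P)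
  also have "\<dots> = emeasure lborel A + emeasure lborel B"
    using AB by (simp only: shift)
  also have "\<dots> = emeasure lborel (A \<union> B)"
    using AB by (intro plus_emeasure) (auto simp: A_def B_def)
  also have "A \<union> B = {t \<in> {0..<2 * pi}. cis t \<in> Z}"
    using a by (auto simp: A_def B_def P_def)
  finally show ?thesis using assms by (simp add: emeasure_circle_haar)
qed

lemma measurable_nu_map:
  assumes "finite_borel_unit_interval \<eta>"
  shows "(\<lambda>(r, \<tau>). of_real r * \<tau>) \<in> measurable (\<eta> \<Otimes>\<^sub>M circle_haar) disk_borel"
proof -
  have \<eta>: "sets \<eta> = sets (restrict_space borel {0..<1})"
    using assms by (simp add: finite_borel_unit_interval_def)
  have sp: "space \<eta> = {0..<1}"
    using sets_eq_imp_space_eq[OF \<eta>] by (simp add: space_restrict_space)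
  have 1: "complex_of_real \<in> borel_measurable \<eta>"
    unfolding measurable_cong_sets[OF \<eta> refl] by (intro measurable_restrict_space1) simp
  have 2: "(\<lambda>\<tau>. \<tau>) \<in> borel_measurable circle_haar"
    unfolding measurable_cong_sets[OF sets_circle_haar refl]
    by (intro measurable_restrict_space1) simp
  have "(\<lambda>p. complex_of_real (fst p) * snd p) \<in> borel_measurable (\<eta> \<Otimes>\<^sub>M circle_haar)"
    by (intro borel_measurable_times
        measurable_compose[OF measurable_fst 1] measurable_compose[OF measurable_snd 2])
  then show ?thesis
    unfolding disk_borel_def split_beta'
    by (intro measurable_restrict_space2)
       (auto simp: space_pair_measure sp space_circle_haar norm_mult)
qed

end

theory Submission
  imports Defs "HOL-Complex_Analysis.Cauchy_Integral_Formula"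
begin

text \<open>Lebesgue measure on the disk is itself of the form \<open>nu \<eta>\<close>, with \<open>\<eta>\<close> the measure \<open>r dr\<close>. For
  power series \<open>f = \<Sum>a\<^sub>n z\<^sup>n\<close> and \<open>g = \<Sum>b\<^sub>n z\<^sup>n\<close>, orthogonality of the characters of the circle gives
  \<open>\<integral> f cnj(g) d(nu \<eta>) = 2\<pi> \<Sum> a\<^sub>n cnj(b\<^sub>n) m\<^sub>n\<close>, where \<open>m\<^sub>n = \<integral> r\<^bsup>2n\<^esup> d\<eta>\<close>. For \<open>r dr\<close> this is the Bergman inner
  product, which identifies \<open>R\<close> and its adjoint; with \<open>g\<close> the Bergman kernel it shows that the Toeplitz
  operator multiplies the \<open>n\<close>-th Taylor coefficient by \<open>2(n+1)m\<^sub>n\<close>; with \<open>f = g = z\<^sup>n\<close> the Carleson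
  condition bounds these multipliers.\<close>

section \<open>Rotations and polar coordinates\<close>

lemma nn_integral_lborel_shift:
  fixes F :: "'a::euclidean_space \<Rightarrow> ennreal"
  assumes [measurable]: "F \<in> borel_measurable borel"
  shows "(\<integral>\<^sup>+x. F (c + x) \<partial>lborel) = (\<integral>\<^sup>+x. F x \<partial>lborel)"
proof -
  have "(\<integral>\<^sup>+x. F x \<partial>lborel) = (\<integral>\<^sup>+x. F x \<partial>distr lborel borel ((+) c))"
    by (simp add: lborel_distr_plus)
  also have "\<dots> = (\<integral>\<^sup>+x. F (c + x) \<partial>lborel)"
    by (subst nn_integral_distr) auto
  finally show ?thesis by simp
qed

text \<open>Integrate \<open>F (\<tau> * x)\<close> times the indicator of \<open>y\<close> lying in the unit disk around \<open>\<tau> * x\<close>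
  in both orders: translation invariance and the rotational symmetry of the disk suffice.\<close>
lemma nn_integral_lborel_rotate:
  fixes F :: "complex \<Rightarrow> ennreal"
  assumes F [measurable]: "F \<in> borel_measurable borel" and \<tau>: "cmod \<tau> = 1"
  shows "(\<integral>\<^sup>+z. F (\<tau> * z) \<partial>lborel) = (\<integral>\<^sup>+z. F z \<partial>lborel)"
proof -
  let ?B = "\<lambda>z. indicator unit_disk z :: ennreal"
  have B [measurable]: "?B \<in> borel_measurable borel" by (rule borel_measurable_indicator) simp
  have vol: "(\<integral>\<^sup>+z. ?B z \<partial>lborel) = ennreal pi"
    by (simp add: emeasure_ball unit_ball_vol_numeral)
  have B1: "?B (- (\<tau> * x)) = ?B x" for x
    using \<tau> by (simp add: indicator_def norm_mult)
  have t1: "\<tau> * (cnj \<tau> * y + x) = \<tau> * x + y" for x y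
  proof -
    have "\<tau> * cnj \<tau> = 1" using \<tau> complex_norm_square[of \<tau>] by simp
    then show ?thesis by (simp add: distrib_left flip: mult.assoc)
  qed
  have "(\<integral>\<^sup>+x. F (\<tau> * x) \<partial>lborel) * ennreal pi
      = (\<integral>\<^sup>+x. (\<integral>\<^sup>+y. F (\<tau> * x) * ?B (- (\<tau> * x) + y) \<partial>lborel) \<partial>lborel)"
    using vol nn_integral_lborel_shift[OF B]
    by (simp add: nn_integral_cmult nn_integral_multc del: nn_integral_indicator uminus_add_conv_diff)
  also have "\<dots> = (\<integral>\<^sup>+y. (\<integral>\<^sup>+x. F (\<tau> * x) * ?B (- (\<tau> * x) + y) \<partial>lborel) \<partial>lborel)"
    by (rule lborel_pair.Fubini') measurable
  \<comment> \<open>For fixed \<open>y\<close>, \<open>x\<close> is translated by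
    \<open>cnj \<tau> * y\<close>: \<open>F\<close> is then evaluated at
    \<open>\<tau> * x + y\<close>, and \<open>y\<close> cancels from the argument of the
    indicator.\<close>
  also have "\<dots> = (\<integral>\<^sup>+y. (\<integral>\<^sup>+x. F (\<tau> * (cnj \<tau> * y + x)) * ?B (- (\<tau> * (cnj \<tau> * y + x)) + y) \<partial>lborel) \<partial>lborel)"
    by (subst nn_integral_lborel_shift[where F = "\<lambda>x. F (\<tau> * x) * ?B (- (\<tau> * x) + _)"]) auto
  also have "\<dots> = (\<integral>\<^sup>+y. (\<integral>\<^sup>+x. F (\<tau> * x + y) * ?B x \<partial>lborel) \<partial>lborel)"
    unfolding t1 by (simp add: B1)
  also have "\<dots> = (\<integral>\<^sup>+x. (\<integral>\<^sup>+y. F (\<tau> * x + y) * ?B x \<partial>lborel) \<partial>lborel)"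
    by (rule lborel_pair.Fubini') measurable
  also have "\<dots> = (\<integral>\<^sup>+y. F y \<partial>lborel) * ennreal pi"
    by (simp add: nn_integral_cmult nn_integral_multc nn_integral_lborel_shift[OF F] vol del: nn_integral_indicator)
  finally show ?thesis
    by (auto simp: mult_right_ennreal_cancel dest: leD)
qed

section \<open>Haar measure on the circle and orthogonality of its characters\<close>

lemma finite_measure_circle_haar: "finite_measure circle_haar"
  by (rule finite_measureI) (simp add: emeasure_circle_haar_space)

lemma space_finite_borel_unit_interval:
  "finite_borel_unit_interval \<eta> \<Longrightarrow> space \<eta> = {0..<1}"
  using sets_eq_imp_space_eq[of \<eta> "restrict_space borel {0..<1}"]
  by (simp add: finite_borel_unit_interval_def space_restrict_space)

lemma measurable_circle_rotate:
  assumes "cmod \<sigma> = 1"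
  shows "(*) \<sigma> \<in> measurable circle_haar circle_haar"
  unfolding measurable_cong_sets[OF sets_circle_haar sets_circle_haar]
  using assms by (intro measurable_restrict_space2 measurable_restrict_space1)
       (auto simp: norm_mult space_restrict_space)

text \<open>The preimage of a set under rotation by \<sigma> is its image under rotation by
  \<open>cnj \<sigma>\<close>, so the invariance of arc length on images carries over to the
  pushforward.\<close>

lemma distr_circle_haar_rotate:
  assumes \<sigma>: "cmod \<sigma> = 1"
  shows "distr circle_haar circle_haar ((*) \<sigma>) = circle_haar"
proof (rule measure_eqI)
  note m = measurable_circle_rotate[OF \<sigma>]
  fix Z assume "Z \<in> sets (distr circle_haar circle_haar ((*) \<sigma>))"
  then have Z: "Z \<in> sets circle_haar" by simp
  then have Z': "Z \<in> sets borel" "Z \<subseteq> unit_circle"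
    by (auto simp: sets_circle_haar sets_restrict_space_iff)
  have "emeasure (distr circle_haar circle_haar ((*) \<sigma>)) Z
      = emeasure circle_haar ((*) \<sigma> -` Z \<inter> space circle_haar)"
    using m Z by (simp add: emeasure_distr)
  also have "(*) \<sigma> -` Z \<inter> space circle_haar = (\<lambda>z. cnj \<sigma> * z) ` Z"
  proof -
    have 1: "cnj \<sigma> * (\<sigma> * z) = z" "\<sigma> * (cnj \<sigma> * z) = z" for z
      using \<sigma> complex_norm_square[of \<sigma>] by (simp_all add: mult.commute flip: mult.assoc)
    show ?thesis
    proof (intro equalityI subsetI)
      fix z assume "z \<in> (*) \<sigma> -` Z \<inter> space circle_haar"
      then show "z \<in> (\<lambda>z. cnj \<sigma> * z) ` Z"
        using 1 by (intro image_eqI[of _ _ "\<sigma> * z"]) auto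
    next
      fix z assume "z \<in> (\<lambda>z. cnj \<sigma> * z) ` Z"
      then show "z \<in> (*) \<sigma> -` Z \<inter> space circle_haar"
        using Z'(2) \<sigma> by (auto simp: space_circle_haar norm_mult 1)
    qed
  qed
  also have "emeasure circle_haar \<dots> = emeasure circle_haar Z"
    using \<sigma> Z' by (intro emeasure_circle_haar_rotate) auto
  finally show "emeasure (distr circle_haar circle_haar ((*) \<sigma>)) Z = emeasure circle_haar Z" .
qed simp

lemma measurable_circle_haar_id: "(\<lambda>\<tau>. \<tau>) \<in> borel_measurable circle_haar"
  unfolding measurable_cong_sets[OF sets_circle_haar refl]
  by (intro measurable_restrict_space1) simp

lemma measurable_circle_haar_borel:
  "h \<in> borel_measurable borel \<Longrightarrow> h \<in> borel_measurable circle_haar"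
  unfolding measurable_cong_sets[OF sets_circle_haar refl]
  by (intro measurable_restrict_space1)

text \<open>For distinct exponents there is a rotation that multiplies the integrand by -1. It also
  preserves the integral, which is therefore zero.\<close>

lemma circle_haar_orthogonal:
  "(LINT \<tau>|circle_haar. \<tau> ^ m * cnj (\<tau> ^ n)) = (if m = n then complex_of_real (2 * pi) else 0)"
proof (cases "m = n")
  case True
  have "(LINT \<tau>|circle_haar. \<tau> ^ m * cnj (\<tau> ^ n)) = (LINT \<tau>|circle_haar. 1)"
    using True by (intro Bochner_Integration.integral_cong)
      (auto simp: space_circle_haar power_mult_distrib[symmetric] complex_norm_square[symmetric])
  also have "\<dots> = complex_of_real (2 * pi)"
    using emeasure_circle_haar_space by (simp add: measure_def scaleR_conv_of_real)
  finally show ?thesis using True by simp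
next
  case False
  \<comment> \<open>The angle \<open>pi / d\<close> is the one at which the character of exponent m
    - n takes the value -1; \<open>d\<close> is real because the difference may be negative.\<close>
  define d where "d = real m - real n"
  define \<sigma> where "\<sigma> = cis (pi / d)"
  define I where "I = (LINT \<tau>|circle_haar. \<tau> ^ m * cnj (\<tau> ^ n))"
  have d: "d \<noteq> 0" using False by (simp add: d_def)
  have "\<sigma> ^ m * cnj (\<sigma> ^ n) = cis (real m * (pi / d)) * cis (- (real n * (pi / d)))"
    by (simp add: \<sigma>_def Complex.DeMoivre cis_cnj)
  also have "\<dots> = cis (d * (pi / d))"
    by (simp add: cis_mult d_def algebra_simps diff_divide_distrib)
  also have "\<dots> = -1" using d by simp
  finally have s: "\<sigma> ^ m * cnj (\<sigma> ^ n) = -1" .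
  have M: "(\<lambda>\<tau>. \<tau> ^ m * cnj (\<tau> ^ n)) \<in> borel_measurable circle_haar"
    by (intro measurable_circle_haar_borel borel_measurable_continuous_onI continuous_intros)
  have "I = (LINT \<tau>|distr circle_haar circle_haar ((*) \<sigma>). \<tau> ^ m * cnj (\<tau> ^ n))"
    by (simp add: I_def distr_circle_haar_rotate \<sigma>_def)
  also have "\<dots> = (LINT \<tau>|circle_haar. (\<sigma> * \<tau>) ^ m * cnj ((\<sigma> * \<tau>) ^ n))"
    by (rule integral_distr[OF measurable_circle_rotate M]) (simp add: \<sigma>_def)
  also have "\<dots> = (LINT \<tau>|circle_haar. (\<sigma> ^ m * cnj (\<sigma> ^ n)) * (\<tau> ^ m * cnj (\<tau> ^ n)))"
    by (intro Bochner_Integration.integral_cong) (auto simp: power_mult_distrib)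
  also have "\<dots> = - I" by (simp only: s integral_mult_right_zero) (simp add: I_def)
  finally have "I = 0" by simp
  then show ?thesis using False by (simp add: I_def)
qed

section \<open>The measure r dr and integration against \<open>nu\<close>\<close>

text \<open>The density is the coercion \<open>ennreal\<close> itself, so this is r dr on [0,1), the
  radial factor of area in polar coordinates.\<close>

definition area_radial :: "real measure" where
  "area_radial = density (restrict_space lborel {0..<1}) ennreal"

lemma finite_borel_area_radial: "finite_borel_unit_interval area_radial"
proof -
  have m [measurable]: "(ennreal :: real \<Rightarrow> ennreal) \<in> borel_measurable borel" by measurable
  have "emeasure area_radial (space area_radial) = (\<integral>\<^sup>+r. ennreal r * indicator {0..<1} r \<partial>lborel)"
    unfolding area_radial_def
    by (subst emeasure_density)
      (auto simp: space_restrict_space nn_integral_restrict_space measurable_restrict_space1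
          sets_restrict_space_iff
        intro!: nn_integral_cong split: split_indicator)
  also have "\<dots> \<le> (\<integral>\<^sup>+r. indicator {0..<1} r \<partial>(lborel :: real measure))"
    by (intro nn_integral_mono) (auto split: split_indicator simp: ennreal_le_1)
  also have "\<dots> < \<infinity>" by simp
  finally have "finite_measure area_radial"
    by (intro finite_measureI) auto
  then show ?thesis
    by (simp add: finite_borel_unit_interval_def area_radial_def sets_restrict_space)
qed

lemma nn_integral_nu:
  assumes \<eta>: "finite_borel_unit_interval \<eta>" and F: "F \<in> borel_measurable disk_borel"
  shows "(\<integral>\<^sup>+z. F z \<partial>nu \<eta>) = (\<integral>\<^sup>+r. (\<integral>\<^sup>+\<tau>. F (of_real r * \<tau>) \<partial>circle_haar) \<partial>\<eta>)"
proof -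
  interpret H: finite_measure circle_haar by (rule finite_measure_circle_haar)
  note m = measurable_nu_map[OF \<eta>]
  have "(\<integral>\<^sup>+z. F z \<partial>nu \<eta>) = (\<integral>\<^sup>+p. F (case p of (r, \<tau>) \<Rightarrow> of_real r * \<tau>) \<partial>(\<eta> \<Otimes>\<^sub>M circle_haar))"
    unfolding nu_def using F by (subst nn_integral_distr[OF m]) auto
  also have "\<dots> = (\<integral>\<^sup>+r. (\<integral>\<^sup>+\<tau>. F (of_real r * \<tau>) \<partial>circle_haar) \<partial>\<eta>)"
    using H.nn_integral_fst[OF measurable_compose[OF m F]] by simp
  finally show ?thesis .
qed

lemma integral_nu:
  fixes F :: "complex \<Rightarrow> complex"
  assumes \<eta>: "finite_borel_unit_interval \<eta>" and F: "integrable (nu \<eta>) F"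
  shows "(LINT z|nu \<eta>. F z) = (LINT r|\<eta>. LINT \<tau>|circle_haar. F (of_real r * \<tau>))"
proof -
  interpret H: finite_measure circle_haar by (rule finite_measure_circle_haar)
  interpret E: finite_measure \<eta> using \<eta> by (simp add: finite_borel_unit_interval_def)
  interpret pair_sigma_finite \<eta> circle_haar ..
  note m = measurable_nu_map[OF \<eta>]
  have Fm: "F \<in> borel_measurable disk_borel"
    using borel_measurable_integrable[OF F] by (simp add: nu_def)
  have int: "integrable (\<eta> \<Otimes>\<^sub>M circle_haar) (\<lambda>p. F (case p of (r, \<tau>) \<Rightarrow> of_real r * \<tau>))"
    using F integrable_distr_eq[OF m Fm] by (simp add: nu_def)
  have "(LINT z|nu \<eta>. F z) = (LINT p|(\<eta> \<Otimes>\<^sub>M circle_haar). F (case p of (r, \<tau>) \<Rightarrow> of_real r * \<tau>))"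
    unfolding nu_def using Fm by (rule integral_distr[OF m])
  also have "\<dots> = (LINT r|\<eta>. LINT \<tau>|circle_haar. F (of_real r * \<tau>))"
    using integral_fst'[OF int] by simp
  finally show ?thesis .
qed

section \<open>Polar coordinates for Lebesgue measure on the disk\<close>

text \<open>Measures on the line that are finite and equal on all rays \<open>{x<..}\<close>
  coincide. On the left a ray has the area of an annulus, on the right an elementary
  integral.\<close>

lemma distr_cmod_disk_lebesgue:
  "distr disk_lebesgue borel cmod = density lborel (\<lambda>r. ennreal (2 * pi * r) * indicator {0..<1} r)"
proof (rule measure_eqI_lessThan)
  have mc: "cmod \<in> borel_measurable disk_lebesgue"
    unfolding disk_lebesgue_def by (intro measurable_restrict_space1) simp
  \<comment> \<open>The area of the part of the disk where the modulus exceeds \<open>x\<close>: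
    everything for negative \<open>x\<close>, nothing from 1 on.\<close>
  define L where "L x = (if x < 0 then pi else if x < 1 then pi - pi * x\<^sup>2 else 0)" for x :: real
  have 1: "emeasure (distr disk_lebesgue borel cmod) {x<..} = ennreal (L x)" for x
  proof -
    have D: "emeasure lborel unit_disk = ennreal pi"
      by (simp add: emeasure_ball unit_ball_vol_numeral)
    have "emeasure (distr disk_lebesgue borel cmod) {x<..}
        = emeasure disk_lebesgue (cmod -` {x<..} \<inter> unit_disk)"
      using mc by (simp add: emeasure_distr) (simp add: disk_lebesgue_def space_restrict_space)
    also have "\<dots> = emeasure lborel (cmod -` {x<..} \<inter> unit_disk)"
      unfolding disk_lebesgue_def by (subst emeasure_restrict_space) auto
    also have "\<dots> = ennreal (L x)"
    proof -
      consider "x < 0" | "0 \<le> x" "x < 1" | "1 \<le> x" by linarith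
      then show ?thesis
      proof cases
        case 1
        then have "cmod -` {x<..} \<inter> unit_disk = unit_disk"
          using less_le_trans[OF 1 norm_ge_zero] by auto
        then show ?thesis using 1 D by (simp add: L_def)
      next
        case 2
        then have "cmod -` {x<..} \<inter> unit_disk = unit_disk - cball 0 x" by auto
        moreover have "emeasure lborel (unit_disk - cball 0 x) = ennreal (pi - pi * x\<^sup>2)"
          using 2 D
          by (subst emeasure_Diff)
             (auto simp: emeasure_cball unit_ball_vol_numeral simp flip: ennreal_minus)
        ultimately show ?thesis using 2 by (simp add: L_def)
      next
        case 3
        then have "cmod -` {x<..} \<inter> unit_disk = {}" by auto
        then show ?thesis using 3 by (simp add: L_def)
      qed
    qed
    finally show ?thesis .
  qed
  have 2: "emeasure (density lborel (\<lambda>r. ennreal (2 * pi * r) * indicator {0..<1} r)) {x<..} = ennreal (L x)" for x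
  proof -
    \<comment> \<open>Clamping \<open>x\<close> to [0,1] covers the three cases of \<open>L\<close>
      by one integral over \<open>{y..1}\<close>, which agrees with the given range up to finitely
      many points.\<close>
    define y where "y = max 0 (min x 1)"
    have "emeasure (density lborel (\<lambda>r. ennreal (2 * pi * r) * indicator {0..<1} r)) {x<..}
        = (\<integral>\<^sup>+r. (ennreal (2 * pi * r) * indicator {0..<1} r) * indicator {x<..} r \<partial>lborel)"
      by (subst emeasure_density) auto
    also have "\<dots> = (\<integral>\<^sup>+r. ennreal (2 * pi * r) * indicator {y..1} r \<partial>lborel)"
    proof (rule nn_integral_cong_AE)
      have "AE r in lborel. r \<noteq> y" "AE r in lborel. r \<noteq> 1" "AE r in lborel. r \<noteq> (0::real)"
        by (auto simp: AE_lborel_singleton)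
      then show "AE r in lborel. (ennreal (2 * pi * r) * indicator {0..<1} r) * indicator {x<..} r
          = ennreal (2 * pi * r) * indicator {y..1} r"
        by eventually_elim (auto split: split_indicator simp: y_def)
    qed
    also have "\<dots> = pi * 1\<^sup>2 - pi * y\<^sup>2"
      by (rule nn_integral_FTC_Icc) (auto simp: y_def intro!: derivative_eq_intros)
    also have "\<dots> = L x" by (auto simp: L_def y_def)
    finally show ?thesis .
  qed
  show "emeasure (distr disk_lebesgue borel cmod) {x<..} < \<infinity>" for x
    by (simp add: 1)
  show "emeasure (distr disk_lebesgue borel cmod) {x<..} =
    emeasure (density lborel (\<lambda>r. ennreal (2 * pi * r) * indicator {0..<1} r)) {x<..}" for x
    by (simp add: 1 2)
qed simp_all

lemma nn_integral_circle_haar_rotate: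
  assumes h: "h \<in> borel_measurable borel" and \<sigma>: "cmod \<sigma> = 1"
  shows "(\<integral>\<^sup>+\<tau>. h (\<sigma> * \<tau>) \<partial>circle_haar) = (\<integral>\<^sup>+\<tau>. h \<tau> \<partial>circle_haar)"
proof -
  have "(\<integral>\<^sup>+\<tau>. h \<tau> \<partial>circle_haar) = (\<integral>\<^sup>+\<tau>. h \<tau> \<partial>distr circle_haar circle_haar ((*) \<sigma>))"
    by (simp add: distr_circle_haar_rotate \<sigma>)
  also have "\<dots> = (\<integral>\<^sup>+\<tau>. h (\<sigma> * \<tau>) \<partial>circle_haar)"
    using measurable_circle_haar_borel[OF h]
    by (subst nn_integral_distr[OF measurable_circle_rotate[OF \<sigma>]]) auto
  finally show ?thesis by simp
qed

text \<open>Averaging Lebesgue measure over all rotations reduces integration over the disk to the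
  distribution of the modulus, which is read off from the areas of discs.\<close>
lemma disk_lebesgue_eq_nu: "disk_lebesgue = nu area_radial"
proof (rule measure_eqI)
  show "sets disk_lebesgue = sets (nu area_radial)"
    by (simp add: nu_def disk_lebesgue_def disk_borel_def sets_restrict_space)
next
  interpret H: finite_measure circle_haar by (rule finite_measure_circle_haar)
  interpret pair_sigma_finite "lborel :: complex measure" circle_haar ..
  fix A assume "A \<in> sets disk_lebesgue"
  then have A: "A \<in> sets borel" "A \<subseteq> unit_disk" and A': "A \<in> sets disk_borel"
    by (auto simp: disk_lebesgue_def disk_borel_def sets_restrict_space_iff)
  let ?\<chi> = "indicator A :: complex \<Rightarrow> ennreal"
  have \<chi> [measurable]: "?\<chi> \<in> borel_measurable borel" using A by simp
  define G where "G r = (\<integral>\<^sup>+\<tau>. ?\<chi> (of_real r * \<tau>) \<partial>circle_haar)" for r :: real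
  note id = measurable_circle_haar_id
  have G [measurable]: "G \<in> borel_measurable borel"
  proof -
    have "(\<lambda>p. ?\<chi> (of_real (fst p) * snd p)) \<in> borel_measurable (borel \<Otimes>\<^sub>M circle_haar)"
      by (intro measurable_compose[OF _ \<chi>] borel_measurable_times
          measurable_compose[OF measurable_snd id] measurable_compose[OF measurable_fst]) simp
    from H.borel_measurable_nn_integral_fst[OF this] show ?thesis
      by (simp add: G_def[abs_def])
  qed
  \<comment> \<open>Writing z = |z| \<sigma>, the factor \<sigma> is absorbed by the invariance of
    the circle measure, so the integral over all rotations depends on |z| alone.\<close>
  have G_cmod: "(\<integral>\<^sup>+\<tau>. ?\<chi> (\<tau> * z) \<partial>circle_haar) = G (cmod z)" for z
  proof -
    obtain \<sigma> where \<sigma>: "cmod \<sigma> = 1" "z = of_real (cmod z) * \<sigma>"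
    proof (cases "z = 0")
      case False
      then show ?thesis by (intro that[of "sgn z"]) (auto simp: norm_divide sgn_eq)
    qed (auto intro: that[of 1])
    have "(\<integral>\<^sup>+\<tau>. ?\<chi> (of_real (cmod z) * (\<sigma> * \<tau>)) \<partial>circle_haar) = G (cmod z)"
      unfolding G_def by (rule nn_integral_circle_haar_rotate[OF _ \<sigma>(1)]) simp
    moreover have "of_real (cmod z) * (\<sigma> * \<tau>) = \<tau> * z" for \<tau>
      using \<sigma>(2)[symmetric] by (simp add: mult.commute flip: mult.assoc)
    ultimately show ?thesis by simp
  qed
  have mc: "cmod \<in> borel_measurable disk_lebesgue"
    unfolding disk_lebesgue_def by (intro measurable_restrict_space1) simp
  \<comment> \<open>All rotates of \<open>A\<close> have the same area, so integrating over the
    circle multiplies it by the total mass 2 pi.\<close>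
  have "emeasure lborel A * ennreal (2 * pi) = (\<integral>\<^sup>+\<tau>. (\<integral>\<^sup>+z. ?\<chi> (\<tau> * z) \<partial>lborel) \<partial>circle_haar)"
  proof -
    have "(\<integral>\<^sup>+z. ?\<chi> (\<tau> * z) \<partial>lborel) = emeasure lborel A" if "\<tau> \<in> space circle_haar" for \<tau>
      using that A by (subst nn_integral_lborel_rotate) (auto simp: space_circle_haar)
    then have "(\<integral>\<^sup>+\<tau>. (\<integral>\<^sup>+z. ?\<chi> (\<tau> * z) \<partial>lborel) \<partial>circle_haar) = (\<integral>\<^sup>+\<tau>. emeasure lborel A \<partial>circle_haar)"
      by (intro nn_integral_cong)
    then show ?thesis by (simp add: emeasure_circle_haar_space del: nn_integral_const)
        (simp add: emeasure_circle_haar_space)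
  qed
  also have "\<dots> = (\<integral>\<^sup>+z. (\<integral>\<^sup>+\<tau>. ?\<chi> (\<tau> * z) \<partial>circle_haar) \<partial>lborel)"
  proof (rule Fubini')
    show "(\<lambda>(x, y). ?\<chi> (y * x)) \<in> borel_measurable (lborel \<Otimes>\<^sub>M circle_haar)"
      unfolding split_beta'
      by (intro measurable_compose[OF _ \<chi>] borel_measurable_times
          measurable_compose[OF measurable_snd id] measurable_compose[OF measurable_fst]) simp
  qed
  also have "\<dots> = (\<integral>\<^sup>+z. G (cmod z) \<partial>lborel)" by (simp add: G_cmod)
  also have "\<dots> = (\<integral>\<^sup>+z. G (cmod z) \<partial>disk_lebesgue)"
  proof -
    \<comment> \<open>Circles of radius at least 1 miss \<open>A\<close>, which cuts the integral
      down to the disk.\<close>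
    have "G (cmod z) = 0" if "z \<notin> unit_disk" for z
    proof -
      have "?\<chi> (of_real (cmod z) * \<tau>) = 0" if "\<tau> \<in> space circle_haar" for \<tau>
        using that A(2) \<open>z \<notin> unit_disk\<close>
        by (auto simp: space_circle_haar norm_mult indicator_def subset_eq dest!: bspec)
      then have "G (cmod z) = (\<integral>\<^sup>+\<tau>. 0 \<partial>circle_haar)"
        unfolding G_def by (intro nn_integral_cong)
      then show ?thesis by simp
    qed
    then show ?thesis
      unfolding disk_lebesgue_def
      by (subst nn_integral_restrict_space) (auto intro!: nn_integral_cong split: split_indicator)
  qed
  also have "\<dots> = (\<integral>\<^sup>+r. G r \<partial>distr disk_lebesgue borel cmod)"
    by (simp add: nn_integral_distr[OF mc])
  \<comment> \<open>The distribution of the modulus is 2 pi r dr; its factor 2 pi will cancel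
    against the mass of the circle.\<close>
  also have "\<dots> = (\<integral>\<^sup>+r. ennreal (2 * pi * r) * indicator {0..<1} r * G r \<partial>lborel)"
    unfolding distr_cmod_disk_lebesgue by (subst nn_integral_density) auto
  also have "\<dots> = (\<integral>\<^sup>+r. ennreal (2 * pi) * (ennreal r * G r * indicator {0..<1} r) \<partial>lborel)"
    by (intro nn_integral_cong) (auto split: split_indicator simp: ennreal_mult ac_simps)
  also have "\<dots> = ennreal (2 * pi) * (\<integral>\<^sup>+r. ennreal r * G r * indicator {0..<1} r \<partial>lborel)"
    by (rule nn_integral_cmult) simp
  also have "(\<integral>\<^sup>+r. ennreal r * G r * indicator {0..<1} r \<partial>lborel) = (\<integral>\<^sup>+r. G r \<partial>area_radial)"
    unfolding area_radial_def
    by (subst nn_integral_density)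
       (auto simp: nn_integral_restrict_space intro!: measurable_restrict_space1)
  also have "\<dots> = (\<integral>\<^sup>+z. ?\<chi> z \<partial>nu area_radial)"
    unfolding G_def by (rule nn_integral_nu[OF finite_borel_area_radial, symmetric]) (use A' in simp)
  also have "\<dots> = emeasure (nu area_radial) A"
    using A' by (intro nn_integral_indicator) (simp add: nu_def)
  finally have "emeasure lborel A = emeasure (nu area_radial) A"
    by (auto simp: mult_right_ennreal_cancel mult.commute[of "ennreal (2 * pi)"] dest: leD)
  moreover have "emeasure disk_lebesgue A = emeasure lborel A"
    unfolding disk_lebesgue_def using A by (subst emeasure_restrict_space) auto
  ultimately show "emeasure disk_lebesgue A = emeasure (nu area_radial) A" by simp
qed

section \<open>Power series on the disk and the measures \<open>nu\<close>\<close>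

text \<open>A relation between coefficients and function, so that convergence on the whole disk is
  part of the hypothesis; values of \<open>f\<close> outside the disk are left free.\<close>

definition disk_series :: "(nat \<Rightarrow> complex) \<Rightarrow> (complex \<Rightarrow> complex) \<Rightarrow> bool" where
  "disk_series a f \<longleftrightarrow> (\<forall>z\<in>unit_disk. (\<lambda>n. a n * z ^ n) sums f z)"

text \<open>Indexed by half the exponent, because |z^n|^2 = r^(2n) on the circle of radius
  r.\<close>

definition moment :: "real measure \<Rightarrow> nat \<Rightarrow> real" where
  "moment \<eta> n = (LINT r|\<eta>. r ^ (2 * n))"

lemma disk_series_abs_summable:
  assumes "disk_series a f" "0 \<le> r" "r < 1"
  shows "summable (\<lambda>n. cmod (a n) * r ^ n)"
proof -
  \<comment> \<open>Convergence at the midpoint of r and 1, which lies strictly beyond r, forces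
    absolute convergence at r.\<close>
  have "summable (\<lambda>n. a n * of_real ((1 + r) / 2) ^ n)"
    using assms by (intro sums_summable) (auto simp: disk_series_def simp del: of_real_divide of_real_add)
  from powser_insidea[OF this, of "of_real r"] assms show ?thesis
    by (simp add: norm_mult norm_power del: of_real_divide of_real_add)
qed

lemma disk_series_measurable:
  assumes "disk_series a f"
  shows "f \<in> borel_measurable disk_borel"
proof -
  have "(\<lambda>z. \<Sum>n. a n * z ^ n) \<in> borel_measurable disk_borel"
    unfolding disk_borel_def by (intro measurable_restrict_space1) measurable
  also have "?this \<longleftrightarrow> ?thesis"
    using assms by (intro measurable_cong)
      (auto simp: disk_borel_def space_restrict_space disk_series_def sums_iff)
  finally show ?thesis .
qed

lemma disk_series_bound:
  assumes "disk_series a f" "z \<in> unit_disk"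
  shows "cmod (f z) \<le> (\<Sum>n. cmod (a n) * cmod z ^ n)"
proof -
  have s: "summable (\<lambda>n. cmod (a n * z ^ n))"
    using disk_series_abs_summable[OF assms(1), of "cmod z"] assms(2)
    by (simp add: norm_mult norm_power)
  have "f z = (\<Sum>n. a n * z ^ n)" using assms by (simp add: disk_series_def sums_iff)
  then show ?thesis using summable_norm[OF s] by (simp add: norm_mult norm_power)
qed

lemma measurable_on_circle:
  assumes "F \<in> borel_measurable disk_borel" "0 \<le> r" "r < 1"
  shows "(\<lambda>\<tau>. F (of_real r * \<tau>)) \<in> borel_measurable circle_haar"
proof (rule measurable_compose[OF _ assms(1)])
  show "(\<lambda>\<tau>. of_real r * \<tau>) \<in> measurable circle_haar disk_borel"
    unfolding disk_borel_def
    using assms(2,3) measurable_circle_haar_id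
    by (intro measurable_restrict_space2) (auto simp: space_circle_haar norm_mult)
qed

section \<open>Parseval's identity on circles of radius below 1\<close>

text \<open>On such a circle the series of \<open>g\<close> is dominated by a convergent series
  independent of \<tau>, so a bounded factor \<open>h\<close> can be integrated against it term by
  term. It is applied with \<open>h\<close> a monomial and with \<open>h\<close> another power
  series.\<close>

lemma circle_integral_sums:
  assumes h: "h \<in> borel_measurable circle_haar" and B: "\<And>\<tau>. cmod \<tau> = 1 \<Longrightarrow> cmod (h \<tau>) \<le> B"
    and g: "disk_series b g" and r: "0 \<le> r" "r < 1"
  shows "(\<lambda>n. cnj (b n) * (LINT \<tau>|circle_haar. h \<tau> * cnj ((of_real r * \<tau>) ^ n)))
    sums (LINT \<tau>|circle_haar. h \<tau> * cnj (g (of_real r * \<tau>)))"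
proof -
  interpret H: finite_measure circle_haar by (rule finite_measure_circle_haar)
  define T where "T n \<tau> = cnj (b n) * (h \<tau> * cnj ((of_real r * \<tau>) ^ n))" for n \<tau>
  note [measurable] = h measurable_circle_haar_id
  have B0: "0 \<le> B" using order_trans[OF norm_ge_zero B[of 1]] by simp
  have T_bound: "cmod (T n \<tau>) \<le> B * (cmod (b n) * r ^ n)" if "\<tau> \<in> space circle_haar" for n \<tau>
  proof -
    have "cmod (T n \<tau>) = cmod (h \<tau>) * (cmod (b n) * r ^ n)"
      using that r by (simp add: T_def norm_mult norm_power space_circle_haar)
    also have "\<dots> \<le> B * (cmod (b n) * r ^ n)"
      using that B[of \<tau>] r by (intro mult_right_mono) (auto simp: space_circle_haar)
    finally show ?thesis .
  qed
  have cm: "cnj \<in> borel_measurable borel"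
    by (intro borel_measurable_continuous_onI continuous_intros)
  have T_meas: "T n \<in> borel_measurable circle_haar" for n
    unfolding T_def[abs_def] by (intro borel_measurable_times measurable_compose[OF _ cm]) measurable
  have T_int: "integrable circle_haar (T n)" for n
    using T_bound by (intro H.integrable_const_bound[OF _ T_meas] AE_I2)
  have sb: "summable (\<lambda>n. cmod (b n) * r ^ n)"
    by (rule disk_series_abs_summable[OF g r])
  have "(\<lambda>n. integral\<^sup>L circle_haar (T n)) sums (LINT \<tau>|circle_haar. (\<Sum>n. T n \<tau>))"
  proof (rule sums_integral[OF T_int])
    show "AE \<tau> in circle_haar. summable (\<lambda>n. norm (T n \<tau>))"
      using T_bound by (intro AE_I2 summable_comparison_test'[OF summable_mult[OF sb, of B], of 0]) auto
    show "summable (\<lambda>n. LINT \<tau>|circle_haar. norm (T n \<tau>))"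
    proof (rule summable_comparison_test'[OF summable_mult[OF sb, of "B * measure circle_haar (space circle_haar)"], of 0])
      fix n
      have "(LINT \<tau>|circle_haar. norm (T n \<tau>)) \<le> (LINT \<tau>|circle_haar. B * (cmod (b n) * r ^ n))"
        using T_bound T_int by (intro integral_mono) auto
      then show "norm (LINT \<tau>|circle_haar. norm (T n \<tau>))
          \<le> B * measure circle_haar (space circle_haar) * (cmod (b n) * r ^ n)"
        by (simp add: ac_simps)
    qed
  qed
  also have "(\<lambda>n. integral\<^sup>L circle_haar (T n))
      = (\<lambda>n. cnj (b n) * (LINT \<tau>|circle_haar. h \<tau> * cnj ((of_real r * \<tau>) ^ n)))"
    by (simp add: T_def[abs_def])
  also have "(LINT \<tau>|circle_haar. (\<Sum>n. T n \<tau>)) = (LINT \<tau>|circle_haar. h \<tau> * cnj (g (of_real r * \<tau>)))"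
  proof (intro Bochner_Integration.integral_cong refl)
    fix \<tau> assume \<tau>: "\<tau> \<in> space circle_haar"
    then have "(\<lambda>n. b n * (of_real r * \<tau>) ^ n) sums g (of_real r * \<tau>)"
      using g r by (auto simp: disk_series_def norm_mult space_circle_haar)
    then have "(\<lambda>n. h \<tau> * cnj (b n * (of_real r * \<tau>) ^ n)) sums (h \<tau> * cnj (g (of_real r * \<tau>)))"
      by (intro sums_mult) (simp only: sums_cnj)
    then have "(\<lambda>n. T n \<tau>) sums (h \<tau> * cnj (g (of_real r * \<tau>)))"
      by (simp add: T_def ac_simps)
    then show "(\<Sum>n. T n \<tau>) = h \<tau> * cnj (g (of_real r * \<tau>))" by (simp add: sums_iff)
  qed
  finally show ?thesis .
qed

text \<open>Termwise integration expands the conjugated factor. Hence the integral is first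
  evaluated with \<open>f\<close> conjugated instead of the monomial, where orthogonality leaves a
  single term, and then conjugated.\<close>

lemma circle_coefficient:
  assumes f: "disk_series a f" and r: "0 \<le> r" "r < 1"
  shows "(LINT \<tau>|circle_haar. f (of_real r * \<tau>) * cnj ((of_real r * \<tau>) ^ k))
    = of_real (2 * pi * r ^ (2 * k)) * a k"
proof -
  have m: "(\<lambda>\<tau>. (of_real r * \<tau>) ^ k) \<in> borel_measurable circle_haar"
    using measurable_circle_haar_id by measurable
  have I: "(LINT \<tau>|circle_haar. (of_real r * \<tau>) ^ k * cnj ((of_real r * \<tau>) ^ n))
      = (if n = k then of_real (2 * pi * r ^ (2 * n)) else 0)" for n
  proof -
    have "(LINT \<tau>|circle_haar. (of_real r * \<tau>) ^ k * cnj ((of_real r * \<tau>) ^ n))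
        = (LINT \<tau>|circle_haar. of_real (r ^ (k + n)) * (\<tau> ^ k * cnj (\<tau> ^ n)))"
      by (intro Bochner_Integration.integral_cong) (auto simp: power_mult_distrib power_add)
    also have "\<dots> = of_real (r ^ (k + n)) * (LINT \<tau>|circle_haar. \<tau> ^ k * cnj (\<tau> ^ n))"
      by (rule integral_mult_right_zero)
    finally show ?thesis
      unfolding circle_haar_orthogonal by (auto simp flip: mult_2)
  qed
  have "(\<lambda>n. cnj (a n) * (LINT \<tau>|circle_haar. (of_real r * \<tau>) ^ k * cnj ((of_real r * \<tau>) ^ n)))
    sums (LINT \<tau>|circle_haar. (of_real r * \<tau>) ^ k * cnj (f (of_real r * \<tau>)))"
    using r by (intro circle_integral_sums[OF m _ f r, of 1])
      (auto simp: norm_power norm_mult power_le_one)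
  moreover have "(\<lambda>n. cnj (a n) * (LINT \<tau>|circle_haar. (of_real r * \<tau>) ^ k * cnj ((of_real r * \<tau>) ^ n)))
      = (\<lambda>n. if n = k then cnj (a n) * of_real (2 * pi * r ^ (2 * n)) else 0)"
    unfolding I by (auto simp: fun_eq_iff)
  ultimately have f_conj: "(LINT \<tau>|circle_haar. (of_real r * \<tau>) ^ k * cnj (f (of_real r * \<tau>)))
      = cnj (a k) * of_real (2 * pi * r ^ (2 * k))"
    using sums_single[of k "\<lambda>n. cnj (a n) * of_real (2 * pi * r ^ (2 * n))"]
    by (auto intro: sums_unique2)
  have "(LINT \<tau>|circle_haar. f (of_real r * \<tau>) * cnj ((of_real r * \<tau>) ^ k))
      = (LINT \<tau>|circle_haar. cnj ((of_real r * \<tau>) ^ k * cnj (f (of_real r * \<tau>))))"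
    by (simp add: mult.commute)
  also have "\<dots> = cnj (LINT \<tau>|circle_haar. (of_real r * \<tau>) ^ k * cnj (f (of_real r * \<tau>)))"
    by (rule Bochner_Integration.integral_cnj)
  also have "\<dots> = of_real (2 * pi * r ^ (2 * k)) * a k"
    unfolding f_conj by simp
  finally show ?thesis .
qed

text \<open>Only \<open>g\<close> is expanded, with \<open>f\<close> as the bounded factor; each
  resulting integral is a Taylor coefficient of \<open>f\<close>. No double series arises.\<close>

lemma circle_inner_sums:
  assumes f: "disk_series a f" and g: "disk_series b g" and r: "0 \<le> r" "r < 1"
  shows "(\<lambda>n. of_real (2 * pi * r ^ (2 * n)) * (a n * cnj (b n)))
    sums (LINT \<tau>|circle_haar. f (of_real r * \<tau>) * cnj (g (of_real r * \<tau>)))"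
proof -
  have "(\<lambda>n. cnj (b n) * (LINT \<tau>|circle_haar. f (of_real r * \<tau>) * cnj ((of_real r * \<tau>) ^ n)))
    sums (LINT \<tau>|circle_haar. f (of_real r * \<tau>) * cnj (g (of_real r * \<tau>)))"
  proof (rule circle_integral_sums[OF measurable_on_circle[OF disk_series_measurable[OF f] r] _ g r])
    show "cmod (f (of_real r * \<tau>)) \<le> (\<Sum>n. cmod (a n) * r ^ n)" if "cmod \<tau> = 1" for \<tau>
      using disk_series_bound[OF f, of "of_real r * \<tau>"] r that by (simp add: norm_mult)
  qed
  then show ?thesis
    unfolding circle_coefficient[OF f r] by (simp add: ac_simps)
qed

section \<open>Moments and integration over the radius\<close>

text \<open>The type of \<open>c\<close> is general enough to cover real and complex integrands at
  once.\<close>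

lemma integrable_power_unit_interval:
  fixes c :: "'a::{banach, second_countable_topology, real_normed_div_algebra}"
  assumes "finite_borel_unit_interval \<eta>"
  shows "integrable \<eta> (\<lambda>r. of_real (r ^ n) * c)"
proof -
  interpret E: finite_measure \<eta> using assms by (simp add: finite_borel_unit_interval_def)
  have "(\<lambda>r. of_real (r ^ n) * c) \<in> borel_measurable \<eta>"
    using assms
    by (subst measurable_cong_sets[of \<eta> "restrict_space borel {0..<1}"])
       (auto simp: finite_borel_unit_interval_def intro!: measurable_restrict_space1
         borel_measurable_continuous_onI continuous_intros)
  then show ?thesis
  proof (rule E.integrable_const_bound[rotated])
    show "AE r in \<eta>. norm (of_real (r ^ n) * c) \<le> norm c"
    proof (rule AE_I2)
      fix r assume "r \<in> space \<eta>"
      then have r: "0 \<le> r" "r < 1" using space_finite_borel_unit_interval[OF assms] by auto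
      have "norm (of_real (r ^ n) * c) \<le> norm (of_real (r ^ n) :: 'a) * norm c"
        by (rule norm_mult_ineq)
      also have "\<dots> \<le> norm c"
        using r by (intro mult_left_le_one_le) (auto simp: power_le_one norm_power)
      finally show "norm (of_real (r ^ n) * c) \<le> norm c" .
    qed
  qed
qed

lemma moment_nonneg: "0 \<le> moment \<eta> n"
  unfolding moment_def by (rule integral_nonneg_AE) simp

lemma moment_le:
  assumes \<eta>: "finite_borel_unit_interval \<eta>"
  shows "moment \<eta> n \<le> moment \<eta> 0"
proof -
  have int: "integrable \<eta> (\<lambda>r. r ^ (2 * n))" for n
    using integrable_power_unit_interval[OF \<eta>, of "2 * n" "1::real"] by simp
  show ?thesis
    unfolding moment_def
    by (intro integral_mono int) (auto simp: space_finite_borel_unit_interval[OF \<eta>] power_le_one)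
qed

text \<open>Parseval on each circle, followed by the exchange of sum and integral for nonnegative
  terms. Both sides may be infinite, so square integrability and weighted square summability of the
  coefficients can be deduced from each other.\<close>

lemma nn_integral_nu_norm_square:
  assumes \<eta>: "finite_borel_unit_interval \<eta>" and f: "disk_series a f"
  shows "(\<integral>\<^sup>+z. ennreal ((cmod (f z))\<^sup>2) \<partial>nu \<eta>)
    = (\<Sum>n. ennreal (2 * pi * ((cmod (a n))\<^sup>2 * moment \<eta> n)))"
proof -
  interpret H: finite_measure circle_haar by (rule finite_measure_circle_haar)
  note fm = disk_series_measurable[OF f]
  have circle: "(\<integral>\<^sup>+\<tau>. ennreal ((cmod (f (of_real r * \<tau>)))\<^sup>2) \<partial>circle_haar)
      = (\<Sum>n. ennreal (r ^ (2 * n) * (2 * pi * (cmod (a n))\<^sup>2)))" if r: "0 \<le> r" "r < 1" for r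
  proof -
    have m: "(\<lambda>\<tau>. f (of_real r * \<tau>)) \<in> borel_measurable circle_haar"
      by (rule measurable_on_circle[OF fm r])
    have int: "integrable circle_haar (\<lambda>\<tau>. (cmod (f (of_real r * \<tau>)))\<^sup>2)"
    proof (rule H.integrable_const_bound)
      show "AE \<tau> in circle_haar. norm ((cmod (f (of_real r * \<tau>)))\<^sup>2) \<le> (\<Sum>n. cmod (a n) * r ^ n)\<^sup>2"
      proof (rule AE_I2)
        fix \<tau> assume "\<tau> \<in> space circle_haar"
        then show "norm ((cmod (f (of_real r * \<tau>)))\<^sup>2) \<le> (\<Sum>n. cmod (a n) * r ^ n)\<^sup>2"
          using disk_series_bound[OF f, of "of_real r * \<tau>"] r
          by (simp add: space_circle_haar norm_mult power_mono)
      qed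
    qed (use m in measurable)
    have "complex_of_real (LINT \<tau>|circle_haar. (cmod (f (of_real r * \<tau>)))\<^sup>2)
        = (LINT \<tau>|circle_haar. complex_of_real ((cmod (f (of_real r * \<tau>)))\<^sup>2))"
      by (rule integral_complex_of_real[symmetric])
    also have "\<dots> = (LINT \<tau>|circle_haar. f (of_real r * \<tau>) * cnj (f (of_real r * \<tau>)))"
      by (simp only: complex_norm_square)
    finally have "(\<lambda>n. of_real (2 * pi * r ^ (2 * n)) * (a n * cnj (a n)))
        sums complex_of_real (LINT \<tau>|circle_haar. (cmod (f (of_real r * \<tau>)))\<^sup>2)"
      using circle_inner_sums[OF f f r] by simp
    also have "(\<lambda>n. of_real (2 * pi * r ^ (2 * n)) * (a n * cnj (a n)))
        = (\<lambda>n. complex_of_real (r ^ (2 * n) * (2 * pi * (cmod (a n))\<^sup>2)))"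
      by (simp add: fun_eq_iff flip: complex_norm_square)
    finally have "(\<lambda>n. r ^ (2 * n) * (2 * pi * (cmod (a n))\<^sup>2))
        sums (LINT \<tau>|circle_haar. (cmod (f (of_real r * \<tau>)))\<^sup>2)"
      by (simp only: sums_of_real_iff)
    then have "(\<Sum>n. ennreal (r ^ (2 * n) * (2 * pi * (cmod (a n))\<^sup>2)))
        = ennreal (LINT \<tau>|circle_haar. (cmod (f (of_real r * \<tau>)))\<^sup>2)"
      using r by (intro suminf_ennreal_eq) auto
    then show ?thesis
      using nn_integral_eq_integral[OF int] by simp
  qed
  have int: "integrable \<eta> (\<lambda>r. r ^ (2 * n) * c)" for n and c :: real
    using integrable_power_unit_interval[OF \<eta>, of "2 * n" c] by simp
  have "(\<integral>\<^sup>+z. ennreal ((cmod (f z))\<^sup>2) \<partial>nu \<eta>)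
      = (\<integral>\<^sup>+r. (\<integral>\<^sup>+\<tau>. ennreal ((cmod (f (of_real r * \<tau>)))\<^sup>2) \<partial>circle_haar) \<partial>\<eta>)"
    using fm by (intro nn_integral_nu[OF \<eta>]) measurable
  also have "\<dots> = (\<integral>\<^sup>+r. (\<Sum>n. ennreal (r ^ (2 * n) * (2 * pi * (cmod (a n))\<^sup>2))) \<partial>\<eta>)"
    by (intro nn_integral_cong circle) (auto simp: space_finite_borel_unit_interval[OF \<eta>])
  also have "\<dots> = (\<Sum>n. \<integral>\<^sup>+r. ennreal (r ^ (2 * n) * (2 * pi * (cmod (a n))\<^sup>2)) \<partial>\<eta>)"
    by (rule nn_integral_suminf)
      (rule measurable_compose[OF borel_measurable_integrable[OF int] measurable_ennreal])
  also have "\<dots> = (\<Sum>n. ennreal (2 * pi * ((cmod (a n))\<^sup>2 * moment \<eta> n)))"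
  proof (intro arg_cong[where f = suminf] ext)
    fix n
    have "(\<integral>\<^sup>+r. ennreal (r ^ (2 * n) * (2 * pi * (cmod (a n))\<^sup>2)) \<partial>\<eta>)
        = ennreal (LINT r|\<eta>. r ^ (2 * n) * (2 * pi * (cmod (a n))\<^sup>2))"
      by (rule nn_integral_eq_integral[OF int]) auto
    then show "(\<integral>\<^sup>+r. ennreal (r ^ (2 * n) * (2 * pi * (cmod (a n))\<^sup>2)) \<partial>\<eta>)
        = ennreal (2 * pi * ((cmod (a n))\<^sup>2 * moment \<eta> n))"
      by (simp add: moment_def ac_simps)
  qed
  finally show ?thesis .
qed

lemma summable_of_nn_integral_finite:
  assumes \<eta>: "finite_borel_unit_interval \<eta>" and f: "disk_series a f"
    and fin: "(\<integral>\<^sup>+z. ennreal ((cmod (f z))\<^sup>2) \<partial>nu \<eta>) < \<infinity>"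
  shows "summable (\<lambda>n. (cmod (a n))\<^sup>2 * moment \<eta> n)"
proof -
  have "summable (\<lambda>n. 2 * pi * ((cmod (a n))\<^sup>2 * moment \<eta> n))"
    using fin unfolding nn_integral_nu_norm_square[OF \<eta> f]
    by (intro summable_suminf_not_top) (auto simp: moment_nonneg)
  from summable_mult[OF this, of "1 / (2 * pi)"] show ?thesis by simp
qed

lemma integrable_nu_norm_square:
  assumes \<eta>: "finite_borel_unit_interval \<eta>" and f: "disk_series a f"
    and s: "summable (\<lambda>n. (cmod (a n))\<^sup>2 * moment \<eta> n)"
  shows "integrable (nu \<eta>) (\<lambda>z. (cmod (f z))\<^sup>2)"
proof (rule integrableI_bounded)
  show "(\<lambda>z. (cmod (f z))\<^sup>2) \<in> borel_measurable (nu \<eta>)"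
    using disk_series_measurable[OF f] by (simp add: nu_def)
  have "(\<Sum>n. ennreal (2 * pi * ((cmod (a n))\<^sup>2 * moment \<eta> n))) \<noteq> top"
    using summable_mult[OF s, of "2 * pi"]
    by (subst ennreal_suminf_neq_top) (auto simp: moment_nonneg)
  then show "(\<integral>\<^sup>+z. ennreal (norm ((cmod (f z))\<^sup>2)) \<partial>nu \<eta>) < \<infinity>"
    using nn_integral_nu_norm_square[OF \<eta> f] by (simp add: less_top)
qed

text \<open>The polarised form of the norm formula: Parseval on each circle, then termwise
  integration over the radius, justified by the two summability hypotheses.\<close>

lemma nu_inner_sums:
  assumes \<eta>: "finite_borel_unit_interval \<eta>" and f: "disk_series a f" and g: "disk_series b g"
    and a: "summable (\<lambda>n. (cmod (a n))\<^sup>2 * moment \<eta> n)"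
    and b: "summable (\<lambda>n. (cmod (b n))\<^sup>2 * moment \<eta> n)"
  shows "(\<lambda>n. of_real (2 * pi * moment \<eta> n) * (a n * cnj (b n)))
    sums (LINT z|nu \<eta>. f z * cnj (g z))"
proof -
  have cm: "cnj \<in> borel_measurable borel"
    by (intro borel_measurable_continuous_onI continuous_intros)
  have meas: "(\<lambda>z. f z * cnj (g z)) \<in> borel_measurable (nu \<eta>)"
    using disk_series_measurable[OF f] measurable_compose[OF disk_series_measurable[OF g] cm]
    by (simp add: nu_def)
  \<comment> \<open>Used twice: to dominate \<open>f z * cnj (g z)\<close> by integrable squares,
    and to dominate the integrated norms of the terms by the two given series.\<close>
  have amgm: "x * y \<le> x\<^sup>2 + y\<^sup>2" if "0 \<le> x" "0 \<le> y" for x y :: real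
    using sum_squares_bound[of x y] mult_nonneg_nonneg[OF that] by simp
  have int: "integrable (nu \<eta>) (\<lambda>z. f z * cnj (g z))"
  proof (rule Bochner_Integration.integrable_bound[OF Bochner_Integration.integrable_add[OF
        integrable_nu_norm_square[OF \<eta> f a] integrable_nu_norm_square[OF \<eta> g b]] meas])
    show "AE z in nu \<eta>. norm (f z * cnj (g z)) \<le> norm ((cmod (f z))\<^sup>2 + (cmod (g z))\<^sup>2)"
      by (intro AE_I2) (simp add: norm_mult amgm)
  qed
  define T where "T n r = complex_of_real (r ^ (2 * n)) * (of_real (2 * pi) * (a n * cnj (b n)))" for n r
  have T_int: "integrable \<eta> (T n)" for n
    unfolding T_def[abs_def] by (rule integrable_power_unit_interval[OF \<eta>])
  have T_norm: "norm (T n r) = r ^ (2 * n) * (2 * pi * (cmod (a n) * cmod (b n)))" if "0 \<le> r" for n r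
    using that by (simp add: T_def norm_mult norm_power)
  have "(\<lambda>n. integral\<^sup>L \<eta> (T n)) sums (LINT r|\<eta>. (\<Sum>n. T n r))"
  proof (rule sums_integral[OF T_int])
    show "AE r in \<eta>. summable (\<lambda>n. norm (T n r))"
    proof (rule AE_I2)
      fix r assume "r \<in> space \<eta>"
      then have r: "0 \<le> r" "r < 1" using space_finite_borel_unit_interval[OF \<eta>] by auto
      note sa = disk_series_abs_summable[OF f r] and sb = disk_series_abs_summable[OF g r]
      \<comment> \<open>For fixed r, r^(2n) is split evenly between the two sequences; one factor is
        bounded by its whole sum, the other supplies the convergence.\<close>
      have le: "cmod (b n) * r ^ n \<le> (\<Sum>n. cmod (b n) * r ^ n)" for n
        using sum_le_suminf[OF sb, of "{n}"] r by simp
      show "summable (\<lambda>n. norm (T n r))"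
      proof (rule summable_comparison_test'[OF summable_mult[OF sa, of "2 * pi * (\<Sum>n. cmod (b n) * r ^ n)"], of 0])
        fix n
        have "r ^ (2 * n) = r ^ n * r ^ n" by (simp add: mult_2 power_add)
        then have "norm (norm (T n r)) = (2 * pi * (cmod (a n) * r ^ n)) * (cmod (b n) * r ^ n)"
          by (simp add: T_norm[OF r(1)])
        also have "\<dots> \<le> (2 * pi * (cmod (a n) * r ^ n)) * (\<Sum>n. cmod (b n) * r ^ n)"
          using r le by (intro mult_left_mono) auto
        finally show "norm (norm (T n r)) \<le> 2 * pi * (\<Sum>n. cmod (b n) * r ^ n) * (cmod (a n) * r ^ n)"
          by (simp add: ac_simps)
      qed
    qed
    show "summable (\<lambda>n. LINT r|\<eta>. norm (T n r))"
    proof (rule summable_comparison_test'[OF summable_mult[OF summable_add[OF a b], of "2 * pi"], of 0])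
      fix n
      have "(LINT r|\<eta>. norm (T n r)) = (LINT r|\<eta>. r ^ (2 * n) * (2 * pi * (cmod (a n) * cmod (b n))))"
        by (intro Bochner_Integration.integral_cong T_norm refl)
          (simp add: space_finite_borel_unit_interval[OF \<eta>])
      also have "\<dots> = 2 * pi * (moment \<eta> n * (cmod (a n) * cmod (b n)))"
        by (simp add: moment_def ac_simps)
      also have "\<dots> \<le> 2 * pi * (moment \<eta> n * ((cmod (a n))\<^sup>2 + (cmod (b n))\<^sup>2))"
        using moment_nonneg by (intro mult_left_mono amgm) auto
      finally show "norm (LINT r|\<eta>. norm (T n r))
          \<le> 2 * pi * ((cmod (a n))\<^sup>2 * moment \<eta> n + (cmod (b n))\<^sup>2 * moment \<eta> n)"
        by (simp add: algebra_simps)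
    qed
  qed
  also have "(\<lambda>n. integral\<^sup>L \<eta> (T n)) = (\<lambda>n. of_real (2 * pi * moment \<eta> n) * (a n * cnj (b n)))"
  proof
    fix n
    have "integral\<^sup>L \<eta> (T n) = (LINT r|\<eta>. complex_of_real (r ^ (2 * n))) * (of_real (2 * pi) * (a n * cnj (b n)))"
      unfolding T_def[abs_def] by (rule integral_mult_left_zero)
    also have "(LINT r|\<eta>. complex_of_real (r ^ (2 * n))) = of_real (moment \<eta> n)"
      unfolding moment_def by (rule integral_complex_of_real)
    finally show "integral\<^sup>L \<eta> (T n) = of_real (2 * pi * moment \<eta> n) * (a n * cnj (b n))"
      by simp
  qed
  also have "(LINT r|\<eta>. (\<Sum>n. T n r)) = (LINT z|nu \<eta>. f z * cnj (g z))"
    unfolding integral_nu[OF \<eta> int]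
  proof (intro Bochner_Integration.integral_cong refl)
    fix r assume "r \<in> space \<eta>"
    then have r: "0 \<le> r" "r < 1" using space_finite_borel_unit_interval[OF \<eta>] by auto
    show "(\<Sum>n. T n r) = (LINT \<tau>|circle_haar. f (of_real r * \<tau>) * cnj (g (of_real r * \<tau>)))"
      using circle_inner_sums[OF f g r] by (simp add: sums_iff T_def ac_simps)
  qed
  finally show ?thesis .
qed

section \<open>Moments of r dr and the operator R on power series\<close>

text \<open>Kept as an integral over the line, because the radial integral in
  \<open>bergman_R\<close> reduces to exactly this form.\<close>

lemma moment_area_radial_integral:
  "moment area_radial n = (LINT r|lborel. indicator {0..<1} r * (r * r ^ (2 * n)))"
proof -
  have "moment area_radial n = (LINT r|restrict_space lborel {0..<1}. r *\<^sub>R r ^ (2 * n))"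
    unfolding moment_def area_radial_def
    by (rule integral_density)
      (auto intro!: measurable_restrict_space1 AE_I2 simp: space_restrict_space)
  also have "\<dots> = (LINT r|lborel. indicator {0..<1} r *\<^sub>R (r *\<^sub>R r ^ (2 * n)))"
    by (rule integral_restrict_space) simp
  finally show ?thesis by simp
qed

lemma moment_area_radial: "moment area_radial n = 1 / (2 * (real n + 1))"
proof -
  have "moment area_radial n = (LINT r|lborel. indicator {0..<1} r * (r * r ^ (2 * n)))"
    by (rule moment_area_radial_integral)
  also have "\<dots> = (LINT r|lborel. r ^ (2 * n + 1) * indicator {0..1} r)"
  proof (rule integral_cong_AE)
    have "AE r in lborel. r \<noteq> (1::real)" by (rule AE_lborel_singleton)
    then show "AE r in lborel. indicator {0..<1} r * (r * r ^ (2 * n))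
        = r ^ (2 * n + 1) * indicator {0..1} (r::real)"
      by eventually_elim (auto split: split_indicator)
  qed auto
  also have "\<dots> = 1 / (2 * (real n + 1))"
    by (subst integral_power) (auto simp: field_simps)
  finally show ?thesis .
qed

text \<open>The inner integral extracts the k-th Taylor coefficient, and the outer one becomes a
  moment of r dr.\<close>

lemma bergman_R_eq:
  assumes f: "disk_series a f"
  shows "bergman_R f k = a k / of_real (sqrt ((real k + 1) / pi))"
proof -
  have inner: "(LINT \<tau>|circle_haar. f (of_real r * \<tau>) * \<tau> powi (- int k) * of_real (r ^ (k + 1)))
      = of_real (r * r ^ (2 * k)) * (2 * pi * a k)" if "r \<in> {0..<1}" for r
  proof -
    have r: "0 \<le> r" "r < 1" using that by auto
    \<comment> \<open>On the circle \<tau>^(-k) is the conjugate of \<tau>^k. Of the k + 1 factors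
      r, k complete the conjugated monomial at r \<tau>, and one remains as the polar
      Jacobian.\<close>
    have "(LINT \<tau>|circle_haar. f (of_real r * \<tau>) * \<tau> powi (- int k) * of_real (r ^ (k + 1)))
        = (LINT \<tau>|circle_haar. of_real r * (f (of_real r * \<tau>) * cnj ((of_real r * \<tau>) ^ k)))"
    proof (intro Bochner_Integration.integral_cong refl)
      fix \<tau> assume "\<tau> \<in> space circle_haar"
      then have \<tau>: "cmod \<tau> = 1" by (simp add: space_circle_haar)
      then have "inverse \<tau> = cnj \<tau>"
        using complex_norm_square[of \<tau>] by (intro inverse_unique) simp
      then have "\<tau> powi (- int k) = cnj \<tau> ^ k" by (simp add: power_int_minus flip: power_inverse)
      then show "f (of_real r * \<tau>) * \<tau> powi (- int k) * of_real (r ^ (k + 1))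
          = of_real r * (f (of_real r * \<tau>) * cnj ((of_real r * \<tau>) ^ k))"
        by (simp add: power_mult_distrib)
    qed
    also have "\<dots> = of_real r * (LINT \<tau>|circle_haar. f (of_real r * \<tau>) * cnj ((of_real r * \<tau>) ^ k))"
      by (rule integral_mult_right_zero)
    also have "\<dots> = of_real (r * r ^ (2 * k)) * (2 * pi * a k)"
      unfolding circle_coefficient[OF f r] by (simp add: ac_simps)
    finally show ?thesis .
  qed
  have "(LINT r:{0..<1}|lborel. LINT \<tau>|circle_haar. f (of_real r * \<tau>) * \<tau> powi (- int k) * of_real (r ^ (k + 1)))
      = (LINT r:{0..<1}|lborel. of_real (r * r ^ (2 * k)) * (2 * pi * a k))"
    by (rule set_lebesgue_integral_cong, simp, intro allI impI, erule inner)
  also have "\<dots> = (LINT r|lborel. complex_of_real (indicator {0..<1} r * (r * r ^ (2 * k))) * (2 * pi * a k))"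
    unfolding set_lebesgue_integral_def
    by (intro Bochner_Integration.integral_cong refl) (auto simp: scaleR_conv_of_real split: split_indicator)
  also have "\<dots> = (LINT r|lborel. complex_of_real (indicator {0..<1} r * (r * r ^ (2 * k)))) * (2 * pi * a k)"
    by (rule integral_mult_left_zero)
  also have "(LINT r|lborel. complex_of_real (indicator {0..<1} r * (r * r ^ (2 * k))))
      = of_real (LINT r|lborel. indicator {0..<1} r * (r * r ^ (2 * k)))"
    by (rule integral_complex_of_real)
  also have "(LINT r|lborel. indicator {0..<1} r * (r * r ^ (2 * k))) = moment area_radial k"
    by (rule moment_area_radial_integral[symmetric])
  finally have "bergman_R f k = of_real (sqrt ((real k + 1) / pi)) * (of_real (moment area_radial k) * (2 * pi * a k))"
    unfolding bergman_R_def by (rule arg_cong)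
  also have "\<dots> = of_real (sqrt ((real k + 1) / pi) * (moment area_radial k * (2 * pi))) * a k"
    by simp
  \<comment> \<open>2 pi times the moment is the inverse square of the normalising factor, so one
    inverse power survives.\<close>
  also have "sqrt ((real k + 1) / pi) * (moment area_radial k * (2 * pi)) = 1 / sqrt ((real k + 1) / pi)"
  proof -
    define s where "s = sqrt ((real k + 1) / pi)"
    have s: "s > 0" "s\<^sup>2 = (real k + 1) / pi" by (simp_all add: s_def)
    have "moment area_radial k * (2 * pi) = 1 / s\<^sup>2"
      unfolding s(2) moment_area_radial by (simp add: field_simps)
    then show ?thesis
      using s(1) unfolding s_def[symmetric] by (simp add: power2_eq_square)
  qed
  finally show ?thesis by simp
qed

section \<open>The Bergman space and the Toeplitz operator\<close>

text \<open>The reciprocal of the Bergman norm of z^k, hence the coefficient in the canonical basis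
  vector b_k.\<close>

definition bergman_weight :: "nat \<Rightarrow> real" where
  "bergman_weight k = sqrt ((real k + 1) / pi)"

text \<open>Cut off outside the disk to fit the extension by zero in \<open>bergman\<close>.\<close>

definition disk_monomial :: "nat \<Rightarrow> complex \<Rightarrow> complex" where
  "disk_monomial k = (\<lambda>z. if z \<in> unit_disk then z ^ k else 0)"

text \<open>The expansion of \<open>c\<close> in the canonical basis, which serves as the explicit
  candidate for the adjoint of R at \<open>c\<close>.\<close>

definition bergman_synthesis :: "(nat \<Rightarrow> complex) \<Rightarrow> complex \<Rightarrow> complex" where
  "bergman_synthesis c =
     (\<lambda>z. if z \<in> unit_disk then \<Sum>k. of_real (bergman_weight k) * c k * z ^ k else 0)"

lemma gamma_seq_moment: "gamma_seq \<eta> k = 2 * (real k + 1) * moment \<eta> k"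
  by (simp add: gamma_seq_def moment_def)

lemma bergman_weight_pos: "0 < bergman_weight k"
  by (simp add: bergman_weight_def)

lemma bergman_weight_square: "(bergman_weight k)\<^sup>2 = (real k + 1) / pi"
  by (simp add: bergman_weight_def)

section \<open>The Bergman space in terms of Taylor coefficients\<close>

lemma bergman_disk_series:
  assumes "f \<in> bergman"
  shows "disk_series (\<lambda>n. (deriv ^^ n) f 0 / fact n) f"
  using assms holomorphic_power_series[of f 0 1]
  by (auto simp: bergman_def disk_series_def)

lemma bergman_summable:
  assumes "f \<in> bergman" "disk_series a f"
  shows "summable (\<lambda>n. (cmod (a n))\<^sup>2 * moment area_radial n)"
proof (rule summable_of_nn_integral_finite[OF finite_borel_area_radial assms(2)])
  have "integrable (nu area_radial) (\<lambda>z. (cmod (f z))\<^sup>2)"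
    using assms(1) by (simp add: bergman_def disk_lebesgue_eq_nu)
  then show "(\<integral>\<^sup>+z. ennreal ((cmod (f z))\<^sup>2) \<partial>nu area_radial) < \<infinity>"
    by (simp add: integrable_iff_bounded)
qed

text \<open>The converse of \<open>bergman_summable\<close>: together they describe the space by a
  weighted square summability of Taylor coefficients.\<close>

lemma bergmanI:
  assumes f: "disk_series a f" and "summable (\<lambda>n. (cmod (a n))\<^sup>2 * moment area_radial n)"
    and "\<And>z. z \<notin> unit_disk \<Longrightarrow> f z = 0"
  shows "f \<in> bergman"
proof -
  have "f holomorphic_on unit_disk"
    using f by (intro power_series_holomorphic[where a = a]) (auto simp: disk_series_def)
  then show ?thesis
    using assms integrable_nu_norm_square[OF finite_borel_area_radial f]
    by (auto simp: bergman_def disk_lebesgue_eq_nu)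
qed

lemma disk_monomial_series: "disk_series (\<lambda>n. if n = k then 1 else 0) (disk_monomial k)"
  unfolding disk_series_def
proof
  fix z :: complex assume "z \<in> unit_disk"
  moreover have "(\<lambda>n. (if n = k then 1 else 0) * z ^ n) = (\<lambda>n. if n = k then z ^ n else 0)"
    by auto
  ultimately show "(\<lambda>n. (if n = k then 1 else 0) * z ^ n) sums disk_monomial k z"
    using sums_single[of k "\<lambda>n. z ^ n"] by (simp add: disk_monomial_def)
qed

lemma disk_monomial_bergman: "disk_monomial k \<in> bergman"
proof (rule bergmanI[OF disk_monomial_series])
  show "summable (\<lambda>n. (cmod (if n = k then 1 else 0))\<^sup>2 * moment area_radial n)"
    by (rule summable_finite[of "{k}"]) auto
qed (auto simp: disk_monomial_def)

text \<open>The general formula for \<open>nu\<close> at the measure r dr, where 2 pi times the n-th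
  moment is pi / (n + 1), the squared norm of z^n.\<close>

lemma bergman_inner_sums:
  assumes f: "f \<in> bergman" "disk_series a f" and g: "g \<in> bergman" "disk_series b g"
  shows "(\<lambda>n. of_real (pi / (real n + 1)) * (a n * cnj (b n))) sums bergman_inner f g"
proof -
  have "2 * pi * moment area_radial n = pi / (real n + 1)" for n
    by (simp add: moment_area_radial field_simps)
  then show ?thesis
    using nu_inner_sums[OF finite_borel_area_radial f(2) g(2) bergman_summable[OF f] bergman_summable[OF g]]
    unfolding bergman_inner_def disk_lebesgue_eq_nu by simp
qed

section \<open>The adjoint of R\<close>

lemma summable_Suc_power:
  fixes r :: real
  assumes "0 \<le> r" "r < 1"
  shows "summable (\<lambda>n. (real n + 1) * r ^ n)"
  using sums_summable[OF geometric_deriv_sums[of r]] assms by (simp add: add.commute)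

text \<open>A square-summable sequence is bounded and the weights grow at most linearly, so the
  terms are dominated by a multiple of (k + 1) |z|^k.\<close>

lemma bergman_synthesis_series:
  assumes "c \<in> l2"
  shows "disk_series (\<lambda>k. of_real (bergman_weight k) * c k) (bergman_synthesis c)"
  unfolding disk_series_def
proof
  fix z :: complex assume z: "z \<in> unit_disk"
  have s: "summable (\<lambda>k. (cmod (c k))\<^sup>2)" using assms by (simp add: l2_def)
  \<comment> \<open>The summand 1 allows the bound |c_k| \<le> 2 |c_k| \<le> |c_k|^2 + 1.\<close>
  define S where "S = (\<Sum>k. (cmod (c k))\<^sup>2) + 1"
  have S: "cmod (c k) \<le> S" for k
  proof -
    have "(cmod (c k))\<^sup>2 \<le> (\<Sum>k. (cmod (c k))\<^sup>2)" using sum_le_suminf[OF s, of "{k}"] by simp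
    moreover have "2 * cmod (c k) \<le> (cmod (c k))\<^sup>2 + 1"
      using sum_squares_bound[of "cmod (c k)" 1] by simp
    ultimately show ?thesis unfolding S_def using norm_ge_zero[of "c k"] by linarith
  qed
  have w: "bergman_weight k \<le> real k + 1" for k
  proof -
    have "(real k + 1) / pi \<le> (real k + 1) / 1"
      using pi_ge_two by (intro divide_left_mono) auto
    also have "\<dots> \<le> (real k + 1)\<^sup>2" by (simp add: power2_eq_square)
    finally show ?thesis unfolding bergman_weight_def by (intro real_le_lsqrt) auto
  qed
  have "summable (\<lambda>k. of_real (bergman_weight k) * c k * z ^ k)"
  proof (rule summable_comparison_test'[of _ 0])
    show "summable (\<lambda>k. S * ((real k + 1) * cmod z ^ k))"
      using z by (intro summable_mult summable_Suc_power) auto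
    fix k
    have "norm (of_real (bergman_weight k) * c k * z ^ k) = bergman_weight k * cmod (c k) * cmod z ^ k"
      using bergman_weight_pos[of k] by (simp add: norm_mult norm_power)
    also have "\<dots> \<le> (real k + 1) * S * cmod z ^ k"
      using w S by (intro mult_right_mono mult_mono) auto
    finally show "norm (of_real (bergman_weight k) * c k * z ^ k) \<le> S * ((real k + 1) * cmod z ^ k)"
      by (simp add: ac_simps)
  qed
  then show "(\<lambda>k. of_real (bergman_weight k) * c k * z ^ k) sums bergman_synthesis c z"
    using z by (auto simp: bergman_synthesis_def intro: summable_sums)
qed

text \<open>The squared weight times the moment of r dr is the constant 1 / (2 pi), so the condition
  on the Taylor coefficients reduces to square summability of \<open>c\<close>.\<close>

lemma bergman_synthesis_bergman:
  assumes "c \<in> l2"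
  shows "bergman_synthesis c \<in> bergman"
proof (rule bergmanI[OF bergman_synthesis_series[OF assms]])
  have "(cmod (of_real (bergman_weight k) * c k))\<^sup>2 * moment area_radial k = (cmod (c k))\<^sup>2 / (2 * pi)" for k
  proof -
    have "(cmod (of_real (bergman_weight k) * c k))\<^sup>2 = (real k + 1) / pi * (cmod (c k))\<^sup>2"
      by (simp add: norm_mult power_mult_distrib bergman_weight_square)
    moreover have "(real k + 1) / pi * (cmod (c k))\<^sup>2 * (1 / (2 * (real k + 1))) = (cmod (c k))\<^sup>2 / (2 * pi)"
      by (simp add: divide_simps)
    ultimately show ?thesis unfolding moment_area_radial by simp
  qed
  then show "summable (\<lambda>k. (cmod (of_real (bergman_weight k) * c k))\<^sup>2 * moment area_radial k)"
    using assms by (simp add: l2_def summable_divide)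
qed (auto simp: bergman_synthesis_def)

text \<open>The adjoint relation. Both pairings are the same series, because pi / (n + 1) times the
  weight is the inverse weight; convergence comes from the Bergman side.\<close>

lemma l2_inner_bergman_R:
  assumes c: "c \<in> l2" and f: "f \<in> bergman"
  shows "l2_inner (bergman_R f) c = bergman_inner f (bergman_synthesis c)"
proof -
  define a where "a = (\<lambda>n. (deriv ^^ n) f 0 / fact n)"
  have fa: "disk_series a f" unfolding a_def by (rule bergman_disk_series[OF f])
  have "(\<lambda>n. of_real (pi / (real n + 1)) * (a n * cnj (of_real (bergman_weight n) * c n)))
      sums bergman_inner f (bergman_synthesis c)"
    by (rule bergman_inner_sums[OF f fa bergman_synthesis_bergman[OF c] bergman_synthesis_series[OF c]])
  moreover have "of_real (pi / (real n + 1)) * (a n * cnj (of_real (bergman_weight n) * c n))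
      = bergman_R f n * cnj (c n)" for n
  proof -
    have "pi / (real n + 1) * bergman_weight n = 1 / bergman_weight n"
      using bergman_weight_square[of n] bergman_weight_pos[of n]
      by (simp add: field_simps power2_eq_square)
    then have "complex_of_real (pi / (real n + 1)) * of_real (bergman_weight n) = 1 / of_real (bergman_weight n)"
      by (metis of_real_1 of_real_divide of_real_mult)
    then have "of_real (pi / (real n + 1)) * of_real (bergman_weight n) * (a n * cnj (c n))
        = 1 / of_real (bergman_weight n) * (a n * cnj (c n))" by simp
    then show ?thesis
      unfolding bergman_R_eq[OF fa] bergman_weight_def[symmetric] by (simp add: ac_simps)
  qed
  ultimately show ?thesis by (simp add: l2_inner_def sums_iff)
qed

text \<open>Pairing with z^k isolates the conjugate of the k-th Taylor coefficient. The coefficients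
  determine a function on the disk, and outside it both functions vanish.\<close>

lemma bergman_eqI:
  assumes x: "x \<in> bergman" and y: "y \<in> bergman"
    and eq: "\<And>k. bergman_inner (disk_monomial k) x = bergman_inner (disk_monomial k) y"
  shows "x = y"
proof -
  have coeff: "bergman_inner (disk_monomial k) f = of_real (pi / (real k + 1)) * cnj (a k)"
    if "f \<in> bergman" "disk_series a f" for f a k
  proof -
    have "(\<lambda>n. of_real (pi / (real n + 1)) * ((if n = k then 1 else 0) * cnj (a n)))
        = (\<lambda>n. if n = k then of_real (pi / (real n + 1)) * cnj (a n) else 0)" by auto
    with bergman_inner_sums[OF disk_monomial_bergman disk_monomial_series that, of k]
    have "(\<lambda>n. if n = k then of_real (pi / (real n + 1)) * cnj (a n) else 0)
        sums bergman_inner (disk_monomial k) f"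
      by (simp only:)
    then show ?thesis by (rule sums_unique2[OF _ sums_single])
  qed
  define a where "a = (\<lambda>n. (deriv ^^ n) x 0 / fact n)"
  define b where "b = (\<lambda>n. (deriv ^^ n) y 0 / fact n)"
  have a: "disk_series a x" and b: "disk_series b y"
    unfolding a_def b_def using x y by (auto intro: bergman_disk_series)
  have "a k = b k" for k
  proof -
    have "complex_of_real (pi / (real k + 1)) \<noteq> 0"
      by (simp add: add_nonneg_eq_0_iff del: of_real_divide)
    moreover have "of_real (pi / (real k + 1)) * cnj (a k) = of_real (pi / (real k + 1)) * cnj (b k)"
      using eq[of k] by (simp only: coeff[OF x a] coeff[OF y b])
    ultimately show ?thesis by (simp only: mult_cancel_left complex_cnj_cancel_iff) auto
  qed
  then have ab: "a = b" by auto
  show ?thesis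
  proof
    fix z show "x z = y z"
    proof (cases "z \<in> unit_disk")
      case True
      then have "(\<lambda>n. a n * z ^ n) sums x z" "(\<lambda>n. a n * z ^ n) sums y z"
        using a b by (simp_all add: disk_series_def ab)
      then show ?thesis by (rule sums_unique2)
    next
      case False
      then show ?thesis using x y by (simp add: bergman_def)
    qed
  qed
qed

text \<open>The description by \<open>THE\<close> is resolved by the adjoint relation for existence
  and by testing against monomials for uniqueness.\<close>

lemma bergman_R_adj_eq:
  assumes c: "c \<in> l2"
  shows "bergman_R_adj c = bergman_synthesis c"
  unfolding bergman_R_adj_def hilbert_adjoint_def
proof (rule the_equality)
  show "bergman_synthesis c \<in> bergman \<and>
      (\<forall>f\<in>bergman. l2_inner (bergman_R f) c = bergman_inner f (bergman_synthesis c))"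
    using bergman_synthesis_bergman l2_inner_bergman_R c by blast
next
  fix x assume x: "x \<in> bergman \<and> (\<forall>f\<in>bergman. l2_inner (bergman_R f) c = bergman_inner f x)"
  show "x = bergman_synthesis c"
  proof (rule bergman_eqI)
    show "bergman_inner (disk_monomial k) x = bergman_inner (disk_monomial k) (bergman_synthesis c)" for k
      using x disk_monomial_bergman[of k] l2_inner_bergman_R[OF c] by metis
  qed (use x bergman_synthesis_bergman[OF c] in auto)
qed

text \<open>Tested against the conjugated Bergman kernel, whose coefficients are \<open>(n + 1) * cnj z ^ n\<close>,
  the inner product formula for the measure is the Taylor expansion of the Toeplitz transform.\<close>
lemma toeplitz_series:
  assumes \<eta>: "finite_borel_unit_interval \<eta>" and f: "disk_series a f"
    and a: "summable (\<lambda>n. (cmod (a n))\<^sup>2 * moment \<eta> n)"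
  shows "disk_series (\<lambda>n. of_real (gamma_seq \<eta> n) * a n) (toeplitz (nu \<eta>) f)"
  unfolding disk_series_def
proof
  fix z :: complex assume z: "z \<in> unit_disk"
  \<comment> \<open>The conjugate of z sits in the coefficients, so that \<open>g\<close> is a power
    series in w and \<open>cnj (g w)\<close> is the kernel in \<open>toeplitz\<close>.\<close>
  define b where "b n = of_nat (Suc n) * cnj z ^ n" for n
  define g where "g w = 1 / (1 - cnj z * w)\<^sup>2" for w
  have g: "disk_series b g"
    unfolding disk_series_def
  proof
    fix w :: complex assume "w \<in> unit_disk"
    then have "cmod (cnj z * w) < 1"
      using z mult_strict_mono[of "cmod z" 1 "cmod w" 1] by (simp add: norm_mult)
    from geometric_deriv_sums[OF this] show "(\<lambda>n. b n * w ^ n) sums g w"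
      by (simp add: b_def g_def power_mult_distrib mult.assoc)
  qed
  have s: "summable (\<lambda>n. cmod (b n))"
    using summable_Suc_power[of "cmod z"] z
    by (simp add: b_def norm_mult norm_power add.commute del: of_nat_Suc)
      (simp add: add.commute)
  \<comment> \<open>The coefficients \<open>b n\<close> are bounded and absolutely summable since
    |z| < 1, and every moment is at most the total mass \<open>moment \<eta> 0\<close>.\<close>
  have b: "summable (\<lambda>n. (cmod (b n))\<^sup>2 * moment \<eta> n)"
  proof (rule summable_comparison_test'[OF summable_mult[OF s, of "(\<Sum>n. cmod (b n)) * moment \<eta> 0"], of 0])
    fix n
    have "cmod (b n) \<le> (\<Sum>n. cmod (b n))" using sum_le_suminf[OF s, of "{n}"] by simp
    then have "(cmod (b n) * moment \<eta> n) * cmod (b n) \<le> ((\<Sum>n. cmod (b n)) * moment \<eta> 0) * cmod (b n)"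
      using moment_nonneg moment_le[OF \<eta>] suminf_nonneg[OF s]
      by (intro mult_right_mono mult_mono) auto
    then show "norm ((cmod (b n))\<^sup>2 * moment \<eta> n) \<le> (\<Sum>n. cmod (b n)) * moment \<eta> 0 * cmod (b n)"
      using moment_nonneg by (simp add: power2_eq_square ac_simps)
  qed
  have "(\<lambda>n. 1 / of_real pi * (of_real (2 * pi * moment \<eta> n) * (a n * cnj (b n))))
      sums (1 / of_real pi * (LINT w|nu \<eta>. f w * cnj (g w)))"
    by (rule sums_mult[OF nu_inner_sums[OF \<eta> f g a b]])
  moreover have "1 / of_real pi * (LINT w|nu \<eta>. f w * cnj (g w)) = toeplitz (nu \<eta>) f z"
    using z by (simp add: toeplitz_def g_def)
  moreover have "1 / of_real pi * (of_real (2 * pi * moment \<eta> n) * (a n * cnj (b n)))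
      = of_real (gamma_seq \<eta> n) * a n * z ^ n" for n
    by (simp add: b_def gamma_seq_moment add.commute)
  ultimately show "(\<lambda>n. of_real (gamma_seq \<eta> n) * a n * z ^ n) sums toeplitz (nu \<eta>) f z"
    by (simp only:)
qed

section \<open>Boundedness of the multipliers and the operator identity\<close>

text \<open>\<open>gamma_seq \<eta> k\<close> is the quotient of the k-th moments of \<eta> and of r
  dr, that is, of the squared norms of z^k under the two measures. A Carleson constant therefore
  bounds it.\<close>

lemma gamma_seq_bounded:
  assumes \<eta>: "finite_borel_unit_interval \<eta>" and "carleson_bergman (nu \<eta>)"
  shows "(\<lambda>k. complex_of_real (gamma_seq \<eta> k)) \<in> linf"
proof -
  obtain C where C: "0 \<le> C" and carleson: "\<And>f. f \<in> bergman \<Longrightarrow>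
      (\<integral>\<^sup>+z. ennreal ((cmod (f z))\<^sup>2) \<partial>nu \<eta>)
        \<le> ennreal C * (\<integral>\<^sup>+z. ennreal ((cmod (f z))\<^sup>2) \<partial>disk_lebesgue)"
    using assms(2) by (auto simp: carleson_bergman_def)
  \<comment> \<open>Stated for an arbitrary \<xi>, to be used for both \<eta> and
    \<open>area_radial\<close>.\<close>
  have norm_monomial: "(\<integral>\<^sup>+z. ennreal ((cmod (disk_monomial k z))\<^sup>2) \<partial>nu \<xi>) = ennreal (2 * pi * moment \<xi> k)"
    if \<xi>: "finite_borel_unit_interval \<xi>" for \<xi> k
  proof -
    have "(\<lambda>n. ennreal (2 * pi * ((cmod (if n = k then 1 else 0))\<^sup>2 * moment \<xi> n)))
        = (\<lambda>n. if n = k then ennreal (2 * pi * moment \<xi> n) else 0)" by auto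
    then show ?thesis
      unfolding nn_integral_nu_norm_square[OF \<xi> disk_monomial_series]
      using sums_unique[OF sums_single[of k "\<lambda>n. ennreal (2 * pi * moment \<xi> n)"]] by simp
  qed
  have "cmod (of_real (gamma_seq \<eta> k)) \<le> C" for k
  proof -
    have "ennreal (2 * pi * moment \<eta> k) \<le> ennreal C * ennreal (2 * pi * moment area_radial k)"
      using carleson[OF disk_monomial_bergman[of k]]
      by (simp only: disk_lebesgue_eq_nu norm_monomial[OF \<eta>] norm_monomial[OF finite_borel_area_radial])
    also have "\<dots> = ennreal (C * (2 * pi * moment area_radial k))"
      using C moment_nonneg by (intro ennreal_mult[symmetric]) auto
    finally have "2 * pi * moment \<eta> k \<le> C * (2 * pi * moment area_radial k)"
      using C moment_nonneg[of _ k] by (subst (asm) ennreal_le_iff) auto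
    then have "moment \<eta> k \<le> C * moment area_radial k" by simp
    then have "gamma_seq \<eta> k \<le> C"
      by (simp add: gamma_seq_moment moment_area_radial field_simps)
    moreover have "0 \<le> gamma_seq \<eta> k"
      using moment_nonneg[of _ k] by (simp add: gamma_seq_moment)
    ultimately show ?thesis by simp
  qed
  then show ?thesis by (auto simp: linf_def bounded_iff)
qed

theorem theorem3p3:
  fixes \<mu> :: "complex measure" and \<eta> :: "real measure"
  assumes "finite_borel_unit_interval \<eta>"
    and "carleson_bergman \<mu>"
    and "radial \<mu>"
    and "\<mu> = nu \<eta>"
  shows "(\<lambda>k. complex_of_real (gamma_seq \<eta> k)) \<in> linf \<and>
    (\<forall>c\<in>l2. bergman_R (toeplitz \<mu> (bergman_R_adj c)) =
      mult_op (\<lambda>k. complex_of_real (gamma_seq \<eta> k)) c)"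
proof (intro conjI ballI)
  note \<eta> = assms(1) and \<mu> = assms(4)
  show "(\<lambda>k. complex_of_real (gamma_seq \<eta> k)) \<in> linf"
    using gamma_seq_bounded[OF \<eta>] assms(2) by (simp add: \<mu>)
  fix c :: "nat \<Rightarrow> complex" assume c: "c \<in> l2"
  let ?f = "bergman_synthesis c"
  note f = bergman_synthesis_bergman[OF c] and series = bergman_synthesis_series[OF c]
  \<comment> \<open>The Carleson condition makes \<open>?f\<close> square integrable for
    \<open>nu \<eta>\<close>, which yields the summability required by the expansion of the Toeplitz
    transform.\<close>
  have "(\<integral>\<^sup>+z. ennreal ((cmod (?f z))\<^sup>2) \<partial>nu \<eta>) < \<infinity>"
  proof -
    obtain C where "(\<integral>\<^sup>+z. ennreal ((cmod (?f z))\<^sup>2) \<partial>nu \<eta>)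
        \<le> ennreal C * (\<integral>\<^sup>+z. ennreal ((cmod (?f z))\<^sup>2) \<partial>disk_lebesgue)"
      using assms(2) f by (auto simp: carleson_bergman_def \<mu>)
    also have "\<dots> < \<infinity>"
      using f by (auto simp: bergman_def integrable_iff_bounded intro!: ennreal_mult_less_top[THEN iffD2])
    finally show ?thesis .
  qed
  then have "summable (\<lambda>n. (cmod (of_real (bergman_weight n) * c n))\<^sup>2 * moment \<eta> n)"
    by (rule summable_of_nn_integral_finite[OF \<eta> series])
  \<comment> \<open>The k-th coefficient is now \<open>gamma_seq \<eta> k\<close> times the weight
    times \<open>c k\<close>, and R divides it by the weight.\<close>
  note T = toeplitz_series[OF \<eta> series this]
  show "bergman_R (toeplitz \<mu> (bergman_R_adj c)) = mult_op (\<lambda>k. complex_of_real (gamma_seq \<eta> k)) c"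
  proof
    fix k
    show "bergman_R (toeplitz \<mu> (bergman_R_adj c)) k = mult_op (\<lambda>k. complex_of_real (gamma_seq \<eta> k)) c k"
      using bergman_weight_pos[of k] bergman_R_eq[OF T, of k]
      by (simp add: bergman_R_adj_eq[OF c] \<mu> mult_op_def bergman_weight_def[symmetric])
  qed
qed

end
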